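(* Let $m$ be a positive integer and $-\frac\pi2<x<\frac\pi2$. Then $$\sum_{n=1}^\infty\frac{(-1)^{n-1}\cos(2n-1)x}{(2n-1)^{2m}}=\frac{(-1)^{m-1}(2\pi)^{2m-1}}{2(2m-1)!}\Big(\zeta'\Big(1-2m,\tfrac14-\tfrac x{2\pi}\Big)-\zeta'\Big(1-2m,\tfrac34-\tfrac x{2\pi}\Big)+\zeta'\Big(1-2m,\tfrac14+\tfrac x{2\pi}\Big)-\zeta'\Big(1-2m,\tfrac34+\tfrac x{2\pi}\Big)\Big).$$
   Context: For $0<a\le 1$ (more generally $a>0$), $\zeta(s,a)$ denotes the Hurwitz zeta function, defined for $\Re s>1$ by $\zeta(s,a)=\sum_{k=0}^\infty (k+a)^{-s}$ and extended by analytic continuation to all complex $s\neq 1$. Throughout, $\zeta'(s,a)$ denotes the partial derivative $\frac{\partial}{\partial s}\zeta(s,a)$ with respect to the first variable $s$. *)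

theory Defs
  imports "HOL-Analysis.Analysis"
begin

text \<open>Hurwitz zeta function for real a > 0: the unique function holomorphic on
  the complex plane minus 1 that agrees with the Dirichlet series
  sum over k of (k + a) powr (-s) on the half plane Re s > 1.
  The (irrelevant) value at the pole s = 1 is fixed to 0 to make the
  description unique.\<close>

definition hurwitz_zeta :: "real \<Rightarrow> complex \<Rightarrow> complex" where
  "hurwitz_zeta a =
     (if \<exists>f. f holomorphic_on (- {1}) \<and> f 1 = 0 \<and>
              (\<forall>s. 1 < Re s \<longrightarrow> f s = (\<Sum>k. complex_of_real (real k + a) powr (- s)))
      then (THE f. f holomorphic_on (- {1}) \<and> f 1 = 0 \<and>
              (\<forall>s. 1 < Re s \<longrightarrow> f s = (\<Sum>k. complex_of_real (real k + a) powr (- s))))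
      else (\<lambda>_. 0))"

definition hurwitz_zeta_deriv :: "real \<Rightarrow> complex \<Rightarrow> complex" where
  "hurwitz_zeta_deriv a s = deriv (hurwitz_zeta a) s"

end

theory Submission
  imports Defs "HOL-Complex_Analysis.Complex_Analysis"
begin

text \<open>
  For \<open>0 < a < 1\<close>, the difference \<open>\<zeta>(s,a) - \<zeta>(s,1-a)\<close> is \<open>1/\<Gamma>(s)\<close> times the Mellin transform of
  \<open>h(t) = sinh((1/2 - a)t) / sinh(t/2)\<close>. The zero of \<open>1/\<Gamma>\<close> at \<open>s = 1 - 2m\<close> reduces the derivative there
  to the value of the continued Mellin transform, which is the integral over \<open>(0,\<infinity>)\<close> of
  \<open>t\<close> to the power \<open>-2m\<close> times \<open>h(t)\<close> minus its Taylor polynomial of degree \<open>2m - 2\<close>. The partial fraction expansion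
  \<open>h(t) = \<Sum>\<^sub>n 4\<lambda>\<^sub>n sin(\<lambda>\<^sub>n a) / (t\<^sup>2 + \<lambda>\<^sub>n\<^sup>2)\<close> with \<open>\<lambda>\<^sub>n = 2\<pi>n\<close> turns it into a multiple of
  the sum of \<open>sin(2\<pi>na)\<close> over \<open>n\<close> to the power \<open>2m\<close>. Adding the cases
  \<open>a = 1/4 - x/(2\<pi>)\<close> and \<open>a = 1/4 + x/(2\<pi>)\<close> leaves \<open>2 sin(\<pi>n/2) cos(nx)\<close>, which vanishes for even \<open>n\<close>.
\<close>

section \<open>Mellin transforms\<close>

text \<open>Pairing \<open>a\<close> with \<open>1 - a\<close> is what makes the derivative
  accessible. With k_a(t) = exp(-at) / (1 - exp(-t)) one has k_(1-a)(t) = -k_a(-t), so h is even and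
  regular at 0. Only even powers of t occur in its Taylor polynomial, and their Mellin poles lie at
  the even points s = -2j. The odd point 1 - 2m is missed, so the continued transform is finite
  there. The pole terms coming from (0,1] then cancel the integrals of the same powers over
  (1,\<infinity>), which leaves one integral over the half line. The Taylor remainder is not
  estimated but computed: long division of the partial fractions gives it as a power of t times a
  series bounded uniformly in t.

  The obstacle is that the partial fraction series converges only conditionally. It is therefore
  handled with its value 1 - 2a at t = 0 split off, and the differential equation in
  \<open>a\<close> is reached by inserting the Fourier series of a^2 - a + 1/6. Since zeta is a
  definite description, its continuation to the whole punctured plane has to be constructed as
  well.\<close>

lemma holomorphic_on_lebesgue_integral:
  fixes f :: "complex \<Rightarrow> 'a \<Rightarrow> complex"
  assumes U: "open U"
    and meas: "\<And>s. s \<in> U \<Longrightarrow> f s \<in> borel_measurable M"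
    and hol: "\<And>t. t \<in> space M \<Longrightarrow> (\<lambda>s. f s t) holomorphic_on U"
    and bd: "\<And>s. s \<in> U \<Longrightarrow> \<exists>r>0. \<exists>g. cball s r \<subseteq> U \<and> integrable M g \<and>
               (\<forall>w\<in>cball s r. \<forall>t\<in>space M. norm (f w t) \<le> g t)"
  shows "(\<lambda>s. LINT t|M. f s t) holomorphic_on U"
proof -
  have int: "integrable M (f s)" if s: "s \<in> U" for s
  proof -
    from bd[OF s] obtain r g where "r > 0" "integrable M g"
      "\<forall>w\<in>cball s r. \<forall>t\<in>space M. norm (f w t) \<le> g t" by blast
    thus ?thesis
      by (intro Bochner_Integration.integrable_bound[OF \<open>integrable M g\<close> meas[OF s]] AE_I2)
         (force intro: order.trans[OF _ abs_ge_self])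
  qed
  have "\<exists>D. ((\<lambda>s. LINT t|M. f s t) has_field_derivative D) (at s)" if s: "s \<in> U" for s
  proof -
    from bd[OF s] obtain r g where r: "r > 0" "cball s r \<subseteq> U" and g: "integrable M g"
      and gb: "\<And>w t. w \<in> cball s r \<Longrightarrow> t \<in> space M \<Longrightarrow> norm (f w t) \<le> g t" by blast
    define d where "d t = deriv (\<lambda>s. f s t) s" for t
    \<comment> \<open>Cauchy's inequality on discs of radius \<open>r/2\<close> inside
      \<open>cball s r\<close> bounds the derivative by \<open>2 * g t / r\<close>. The difference
      quotients thus have an integrable majorant independent of \<open>y\<close>.\<close>
    have lip: "norm (f y t - f s t) \<le> (2 * g t / r) * norm (y - s)"
      if y: "y \<in> ball s (r/2)" and t: "t \<in> space M" for y t
    proof (rule field_differentiable_bound[of "ball s (r/2)" _ "deriv (\<lambda>s. f s t)"])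
      show "((\<lambda>s. f s t) has_field_derivative deriv (\<lambda>s. f s t) z) (at z within ball s (r/2))"
        if z: "z \<in> ball s (r/2)" for z
      proof (rule holomorphic_derivI[OF hol[OF t] U])
        show "z \<in> U" using z r by (intro subsetD[OF r(2)]) auto
      qed
      show "norm (deriv (\<lambda>s. f s t) z) \<le> 2 * g t / r" if z: "z \<in> ball s (r/2)" for z
      proof -
        have sub: "cball z (r/2) \<subseteq> cball s r"
        proof
          fix x assume "x \<in> cball z (r/2)"
          thus "x \<in> cball s r" using z dist_triangle[of s x z] by simp
        qed
        have h: "(\<lambda>s. f s t) holomorphic_on cball z (r/2)"
          using holomorphic_on_subset[OF hol[OF t]] sub r(2) by blast
        have "norm ((deriv ^^ 1) (\<lambda>s. f s t) z) \<le> fact 1 * g t / (r/2)^1"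
        proof (rule Cauchy_inequality)
          show "(\<lambda>s. f s t) holomorphic_on ball z (r/2)"
            by (rule holomorphic_on_subset[OF h]) auto
          show "continuous_on (cball z (r/2)) (\<lambda>s. f s t)"
            by (rule holomorphic_on_imp_continuous_on[OF h])
          show "norm (f x t) \<le> g t" if "norm (z - x) = r/2" for x
            using that sub by (intro gb t) (auto simp: dist_norm)
        qed (use r in auto)
        thus ?thesis by (simp add: field_simps)
      qed
    qed (use y r in auto)
    have "((\<lambda>y. ((LINT t|M. f y t) - (LINT t|M. f s t)) / (y - s)) \<longlongrightarrow> (LINT t|M. d t)) (at s)"
      unfolding tendsto_at_iff_sequentially
    proof (intro allI impI)
      fix X :: "nat \<Rightarrow> complex" assume X: "\<forall>i. X i \<in> UNIV - {s}" "X \<longlonglongrightarrow> s"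
      have "eventually (\<lambda>i. X i \<in> ball s (r/2)) sequentially"
        using X(2) r by (intro topological_tendstoD) auto
      then obtain N where N: "\<And>i. i \<ge> N \<Longrightarrow> X i \<in> ball s (r/2)"
        by (auto simp: eventually_sequentially)
      \<comment> \<open>Dropping finitely many terms puts the whole sequence into the half-radius
        ball; the shift is undone by \<open>LIMSEQ_offset\<close>.\<close>
      define Y where "Y i = X (i + N)" for i
      have Y: "Y i \<in> ball s (r/2)" "Y i \<noteq> s" for i using N X by (auto simp: Y_def)
      have YU: "Y i \<in> U" for i using Y(1)[of i] r by (intro subsetD[OF r(2)]) auto
      have Yl: "Y \<longlonglongrightarrow> s" unfolding Y_def using X(2) by (rule LIMSEQ_ignore_initial_segment)
      have lim: "(\<lambda>i. (f (Y i) t - f s t) / (Y i - s)) \<longlonglongrightarrow> d t" if t: "t \<in> space M" for t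
      proof -
        have "((\<lambda>s. f s t) has_field_derivative d t) (at s)"
          unfolding d_def by (rule holomorphic_derivI[OF hol[OF t] U s])
        hence "((\<lambda>y. (f y t - f s t) / (y - s)) \<longlongrightarrow> d t) (at s)"
          by (simp add: has_field_derivative_iff)
        thus ?thesis using Yl Y(2) unfolding tendsto_at_iff_sequentially o_def by auto
      qed
      have mq: "(\<lambda>t. (f (Y i) t - f s t) / (Y i - s)) \<in> borel_measurable M" for i
        using meas[OF YU[of i]] meas[OF s] by measurable
      have "(\<lambda>i. LINT t|M. (f (Y i) t - f s t) / (Y i - s)) \<longlonglongrightarrow> (LINT t|M. d t)"
      proof (rule integral_dominated_convergence[where w = "\<lambda>t. 2 * g t / r"])
        show "d \<in> borel_measurable M"
          by (rule borel_measurable_LIMSEQ_metric[OF mq lim])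
        show "AE t in M. norm ((f (Y i) t - f s t) / (Y i - s)) \<le> 2 * g t / r" for i
          using lip[OF Y(1)[of i]] Y(2)[of i]
          by (intro AE_I2) (simp add: norm_divide divide_le_eq)
      qed (use g mq lim in auto)
      also have "(\<lambda>i. LINT t|M. (f (Y i) t - f s t) / (Y i - s)) =
          (\<lambda>i. ((LINT t|M. f (Y i) t) - (LINT t|M. f s t)) / (Y i - s))"
        using int[OF YU] int[OF s] by simp
      finally have "(\<lambda>i. ((LINT t|M. f (X (i + N)) t) - (LINT t|M. f s t)) / (X (i + N) - s))
          \<longlonglongrightarrow> (LINT t|M. d t)" by (simp add: Y_def)
      from LIMSEQ_offset[OF this]
      show "((\<lambda>y. ((LINT t|M. f y t) - (LINT t|M. f s t)) / (y - s)) \<circ> X) \<longlonglongrightarrow> (LINT t|M. d t)"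
        by (simp add: o_def)
    qed
    thus ?thesis unfolding has_field_derivative_iff by blast
  qed
  thus ?thesis
    using U by (auto simp: holomorphic_on_open)
qed

text \<open>Gauge integrals live on the completed Lebesgue measure; Borel measurability of the
  integrand brings them down to \<open>lborel\<close>, where the interchange theorems are
  applied.\<close>

lemma set_integrable_lborel_absolutely_integrable_on:
  fixes f :: "'a::euclidean_space \<Rightarrow> 'b::euclidean_space"
  assumes "f absolutely_integrable_on S" "S \<in> sets borel" "f \<in> borel_measurable borel"
  shows "set_integrable lborel S f"
proof -
  have "(\<lambda>x. indicator S x *\<^sub>R f x) \<in> borel_measurable lborel"
    using assms(2,3) by simp
  thus ?thesis
    using assms(1) integrable_completion unfolding set_integrable_def by blast
qed

lemma set_integrable_lborel_has_integral:
  fixes f :: "real \<Rightarrow> real"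
  assumes "(f has_integral I) S" "S \<in> sets borel" "f \<in> borel_measurable borel"
    and "\<And>x. x \<in> S \<Longrightarrow> 0 \<le> f x"
  shows "set_integrable lborel S f" "(LINT x:S|lborel. f x) = I"
proof -
  show *: "set_integrable lborel S f"
    using assms by (intro set_integrable_lborel_absolutely_integrable_on nonnegative_absolutely_integrable_1)
      auto
  show "(LINT x:S|lborel. f x) = I"
    using set_borel_integral_eq_integral(2)[OF *] assms(1) by (simp add: integral_unique)
qed

lemma set_integrable_powr_unit:
  assumes "e > -1"
  shows "set_integrable lborel {0<..1} (\<lambda>t::real. t powr e)"
    "(LINT t:{0<..1}|lborel. t powr e) = 1 / (e + 1)"
proof -
  have "((\<lambda>t::real. t powr e) has_integral 1 / (e + 1)) {0<..1}"
    using has_integral_powr_from_0[OF assms, of 1]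
    by (subst has_integral_spike_set_eq[of _ "{0..1}"]) (auto intro: negligible_subset[of "{0}"])
  thus "set_integrable lborel {0<..1} (\<lambda>t::real. t powr e)"
    "(LINT t:{0<..1}|lborel. t powr e) = 1 / (e + 1)"
    by (auto intro!: set_integrable_lborel_has_integral)
qed

lemma set_integrable_powr_exp:
  assumes "e > -1" "c > 0"
  shows "set_integrable lborel {0<..} (\<lambda>t::real. t powr e * exp (- (c * t)))"
proof -
  have "(\<lambda>t. complex_of_real t powr (of_real (e+1) - 1) / of_real (exp (c * t))) absolutely_integrable_on {0<..}"
    using assms by (intro absolutely_integrable_Gamma_integral) auto
  hence "set_integrable lborel {0<..} (\<lambda>t. complex_of_real t powr (of_real (e+1) - 1) / of_real (exp (c * t)))"
    by (rule set_integrable_lborel_absolutely_integrable_on) measurable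
  hence "set_integrable lborel {0<..} (\<lambda>t. norm (complex_of_real t powr (of_real (e+1) - 1) / of_real (exp (c * t))))"
    by (rule set_integrable_norm)
  also have "?this \<longleftrightarrow> ?thesis"
    unfolding set_integrable_def
    by (intro Bochner_Integration.integrable_cong refl)
       (auto simp: norm_divide norm_powr_real_powr indicator_def exp_minus field_simps)
  finally show ?thesis .
qed

text \<open>The integrand is named rather than the transform, because its integrals over (0,1],
  (1,\<infinity>) and (0,\<infinity>) are all needed.\<close>

definition mellin_kernel :: "(real \<Rightarrow> real) \<Rightarrow> complex \<Rightarrow> real \<Rightarrow> complex" where
  "mellin_kernel f s t = of_real t powr (s - 1) * of_real (f t)"

lemma measurable_mellin_kernel [measurable]:
  assumes "f \<in> borel_measurable borel"
  shows "mellin_kernel f s \<in> borel_measurable borel"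
proof -
  have "mellin_kernel f s = (\<lambda>t. of_real t powr (s - 1) * of_real (f t))"
    by (auto simp: mellin_kernel_def)
  thus ?thesis using assms by simp
qed

lemma norm_mellin_kernel:
  "t > 0 \<Longrightarrow> norm (mellin_kernel f s t) = t powr (Re s - 1) * \<bar>f t\<bar>"
  by (simp add: mellin_kernel_def norm_mult norm_powr_real_powr)

text \<open>On (0,1] a larger real part makes the power smaller, so the majorant at the least real
  part of a disc serves the whole disc. It is integrable as long as that real part exceeds
  \<open>-q\<close>.\<close>

lemma mellin_unit_interval:
  fixes f :: "real \<Rightarrow> real"
  assumes f: "f \<in> borel_measurable borel" and b: "\<And>t. 0 < t \<Longrightarrow> t \<le> 1 \<Longrightarrow> \<bar>f t\<bar> \<le> C * t powr q"
  shows "Re s > -q \<Longrightarrow> set_integrable lborel {0<..1} (mellin_kernel f s)"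
    and "(\<lambda>s. LINT t:{0<..1}|lborel. mellin_kernel f s t) holomorphic_on {s. Re s > -q}"
proof -
  have C: "C \<ge> 0" using b[of 1] by simp
  have bd: "norm (indicator {0<..1} t *\<^sub>R mellin_kernel f w t) \<le> indicator {0<..1} t *\<^sub>R (C * t powr (\<sigma> - 1 + q))"
    if "\<sigma> \<le> Re w" for w \<sigma> t
  proof (cases "0 < t \<and> t \<le> 1")
    case True
    have "t powr (Re w - 1) * \<bar>f t\<bar> \<le> t powr (\<sigma> - 1) * (C * t powr q)"
      using True that b[of t] by (intro mult_mono powr_mono') auto
    thus ?thesis using True by (simp add: norm_mellin_kernel powr_add mult_ac)
  qed auto
  have int: "integrable lborel (\<lambda>t::real. indicator {0<..1} t *\<^sub>R (C * t powr (\<sigma> - 1 + q)))" if "\<sigma> > -q" for \<sigma>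
    using set_integrable_mult_right[OF set_integrable_powr_unit(1)[of "\<sigma> - 1 + q"], of C] that
    by (simp add: set_integrable_def)
  have ms: "(\<lambda>t. indicator {0<..1} t *\<^sub>R mellin_kernel f s t) \<in> borel_measurable lborel" for s
    using measurable_mellin_kernel[OF f, of s] by measurable
  show "set_integrable lborel {0<..1} (mellin_kernel f s)" if "Re s > -q"
    unfolding set_integrable_def
    by (rule Bochner_Integration.integrable_bound[OF int[OF that] ms AE_I2])
       (use bd[of "Re s" s] in \<open>force intro: order.trans[OF _ abs_ge_self]\<close>)
  show "(\<lambda>s. LINT t:{0<..1}|lborel. mellin_kernel f s t) holomorphic_on {s. Re s > -q}"
    unfolding set_lebesgue_integral_def
  proof (rule holomorphic_on_lebesgue_integral[OF _ ms])
    show "open {s. - q < Re s}" by (rule open_halfspace_Re_gt)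
    show "(\<lambda>s. indicator {0<..1} t *\<^sub>R mellin_kernel f s t) holomorphic_on {s. - q < Re s}" for t
    proof (cases "0 < t \<and> t \<le> 1")
      case True
      thus ?thesis unfolding mellin_kernel_def scaleR_conv_of_real
        by (auto intro!: holomorphic_intros)
    qed auto
    fix s assume s: "s \<in> {s. - q < Re s}"
    \<comment> \<open>Half the distance to the boundary line, so that the closed disc stays in the
      half plane.\<close>
    define r where "r = (Re s + q) / 2"
    have r: "r > 0" using s by (simp add: r_def)
    have le: "Re s - r \<le> Re w" if "w \<in> cball s r" for w
      using that abs_Re_le_cmod[of "s - w"] by (simp add: dist_norm)
    have gr: "Re s - r > -q" using s by (simp add: r_def field_simps)
    show "\<exists>r>0. \<exists>g. cball s r \<subseteq> {s. - q < Re s} \<and> integrable lborel g \<and>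
               (\<forall>w\<in>cball s r. \<forall>t\<in>space lborel. norm (indicator {0<..1} t *\<^sub>R mellin_kernel f w t) \<le> g t)"
    proof (intro exI[of _ r] exI[of _ "\<lambda>t. indicator {0<..1} t *\<^sub>R (C * t powr ((Re s - r) - 1 + q))"] conjI ballI)
      show "cball s r \<subseteq> {s. - q < Re s}" using le gr by fastforce
    qed (use r le bd int[OF gr] in blast)+
  qed
qed

text \<open>Here the majorant sits at an upper bound of the real parts; the exponential decay
  absorbs every power, so the transform is entire.\<close>

lemma mellin_ray:
  fixes f :: "real \<Rightarrow> real"
  assumes f: "f \<in> borel_measurable borel" and c: "c > 0"
    and b: "\<And>t. 1 < t \<Longrightarrow> \<bar>f t\<bar> \<le> C * exp (- (c * t))"
  shows "set_integrable lborel {1<..} (mellin_kernel f s)"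
    and "(\<lambda>s. LINT t:{1<..}|lborel. mellin_kernel f s t) holomorphic_on UNIV"
proof -
  have C: "C \<ge> 0" using order.trans[OF abs_ge_zero b[of 2]] by (simp add: zero_le_mult_iff)
  have bd: "norm (indicator {1<..} t *\<^sub>R mellin_kernel f w t) \<le> indicator {1<..} t *\<^sub>R (C * (t powr (\<sigma> - 1) * exp (- (c * t))))"
    if "Re w \<le> \<sigma>" for w \<sigma> t
  proof (cases "1 < t")
    case True
    have "t powr (Re w - 1) * \<bar>f t\<bar> \<le> t powr (\<sigma> - 1) * (C * exp (- (c * t)))"
      using True that b[of t] by (intro mult_mono powr_mono) auto
    thus ?thesis using True by (simp add: norm_mellin_kernel mult_ac)
  qed auto
  have int: "integrable lborel (\<lambda>t::real. indicator {1<..} t *\<^sub>R (C * (t powr (\<sigma> - 1) * exp (- (c * t)))))" if "\<sigma> > 0" for \<sigma>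
  proof -
    have "set_integrable lborel {1<..} (\<lambda>t::real. t powr (\<sigma> - 1) * exp (- (c * t)))"
      by (rule set_integrable_subset[OF set_integrable_powr_exp]) (use that c in auto)
    from set_integrable_mult_right[OF this, of C] show ?thesis
      by (simp add: set_integrable_def)
  qed
  have ms: "(\<lambda>t. indicator {1<..} t *\<^sub>R mellin_kernel f s t) \<in> borel_measurable lborel" for s
    using measurable_mellin_kernel[OF f, of s] by measurable
  \<comment> \<open>Integrability of the majorant is inherited from the whole half line, where the
    exponent must exceed -1; hence the real part is raised to at least 1.\<close>
  have "Re s \<le> max 1 (Re s)" by simp
  have "max 1 (Re s) > 0" by simp
  show "set_integrable lborel {1<..} (mellin_kernel f s)"
    unfolding set_integrable_def
    by (rule Bochner_Integration.integrable_bound[OF int[OF \<open>max 1 (Re s) > 0\<close>] ms AE_I2])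
       (use bd[OF \<open>Re s \<le> max 1 (Re s)\<close>] in \<open>force intro: order.trans[OF _ abs_ge_self]\<close>)
  show "(\<lambda>s. LINT t:{1<..}|lborel. mellin_kernel f s t) holomorphic_on UNIV"
    unfolding set_lebesgue_integral_def
  proof (rule holomorphic_on_lebesgue_integral[OF _ ms])
    show "(\<lambda>s. indicator {1<..} t *\<^sub>R mellin_kernel f s t) holomorphic_on UNIV" for t
    proof (cases "1 < t")
      case True
      thus ?thesis unfolding mellin_kernel_def scaleR_conv_of_real
        by (auto intro!: holomorphic_intros)
    qed auto
    fix s :: complex
    define \<sigma> where "\<sigma> = max 1 (Re s + 1)"
    have gr: "\<sigma> > 0" by (simp add: \<sigma>_def)
    have le: "Re w \<le> \<sigma>" if "w \<in> cball s 1" for w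
      using that abs_Re_le_cmod[of "s - w"] by (simp add: dist_norm \<sigma>_def)
    show "\<exists>r>0. \<exists>g. cball s r \<subseteq> UNIV \<and> integrable lborel g \<and>
               (\<forall>w\<in>cball s r. \<forall>t\<in>space lborel. norm (indicator {1<..} t *\<^sub>R mellin_kernel f w t) \<le> g t)"
      by (intro exI[of _ 1] exI[of _ "\<lambda>t. indicator {1<..} t *\<^sub>R (C * (t powr (\<sigma> - 1) * exp (- (c * t))))"] conjI)
         (use le bd int[OF gr] in auto)
  qed auto
qed

lemma mellin_powr_unit:
  fixes p :: real
  assumes "Re s > -p"
  shows "set_integrable lborel {0<..1} (mellin_kernel (\<lambda>t. t powr p) s)"
    and "(LINT t:{0<..1}|lborel. mellin_kernel (\<lambda>t. t powr p) s t) = 1 / (s + of_real p)"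
proof -
  show *: "set_integrable lborel {0<..1} (mellin_kernel (\<lambda>t. t powr p) s)"
    by (rule mellin_unit_interval(1)[where C = 1 and q = p]) (use assms in auto)
  define z where "z = s + of_real p"
  have z: "Re z > 0" using assms by (simp add: z_def)
  have "((\<lambda>t. complex_of_real t powr (z - 1)) has_integral
          (of_real 1 powr z / z - of_real 0 powr z / z)) {0..1}" using z
    by (intro fundamental_theorem_of_calculus_interior)
       (auto intro!: continuous_intros derivative_eq_intros has_vector_derivative_real_field)
  hence "((\<lambda>t. complex_of_real t powr (z - 1)) has_integral 1 / z) {0<..1}"
    by (subst has_integral_spike_set_eq[of _ "{0..1}"]) (auto intro: negligible_subset[of "{0}"])
  hence "(mellin_kernel (\<lambda>t. t powr p) s has_integral 1 / z) {0<..1}"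
  proof (rule has_integral_eq[rotated])
    fix t :: real assume "t \<in> {0<..1}"
    moreover have "z - 1 = (s - 1) + of_real p" by (simp add: z_def)
    ultimately show "of_real t powr (z - 1) = mellin_kernel (\<lambda>t. t powr p) s t"
      by (simp only: mellin_kernel_def powr_add) (simp add: powr_of_real)
  qed
  thus "(LINT t:{0<..1}|lborel. mellin_kernel (\<lambda>t. t powr p) s t) = 1 / (s + of_real p)"
    using set_borel_integral_eq_integral(2)[OF *] by (simp add: integral_unique z_def)
qed

text \<open>The powers are subtracted on (0,1] only, since on (1,\<infinity>) they would destroy the
  decay. The identity is stated for Re s > 1, but its right-hand side makes sense for Re s >
  \<open>-q\<close> away from the poles \<open>- p j\<close>: it is the source of every continuation
  below.\<close>

lemma mellin_expansion:
  fixes f :: "real \<Rightarrow> real" and b p :: "'j \<Rightarrow> real"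
  defines "\<rho> \<equiv> (\<lambda>J t. f t - (\<Sum>j\<in>J. b j * t powr p j))"
  assumes f: "f \<in> borel_measurable borel" and c: "c > 0" and J: "finite J"
    and ray: "\<And>t. 1 < t \<Longrightarrow> \<bar>f t\<bar> \<le> C * exp (- (c * t))"
    and unit: "\<And>t. 0 < t \<Longrightarrow> t \<le> 1 \<Longrightarrow> \<bar>\<rho> J t\<bar> \<le> D * t powr q"
    and q: "q \<ge> -1" and p: "\<And>j. j \<in> J \<Longrightarrow> p j \<ge> -1"
    and s: "Re s > 1"
  shows "set_integrable lborel {0<..} (mellin_kernel f s)"
    and "(LINT t:{0<..}|lborel. mellin_kernel f s t) =
      (LINT t:{0<..1}|lborel. mellin_kernel (\<rho> J) s t) + (\<Sum>j\<in>J. of_real (b j) / (s + of_real (p j))) +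
      (LINT t:{1<..}|lborel. mellin_kernel f s t)"
proof -
  have \<rho>: "\<rho> J \<in> borel_measurable borel" using f unfolding \<rho>_def by measurable
  have I1: "set_integrable lborel {0<..1} (mellin_kernel (\<rho> J) s)"
    by (rule mellin_unit_interval(1)[OF \<rho> unit]) (use s q in auto)
  have Ip: "set_integrable lborel {0<..1} (mellin_kernel (\<lambda>t. t powr p j) s)"
    "(LINT t:{0<..1}|lborel. mellin_kernel (\<lambda>t. t powr p j) s t) = 1 / (s + of_real (p j))" if "j \<in> J" for j
    using mellin_powr_unit[of "p j" s] p[OF that] s by auto
  have eq: "mellin_kernel f s = (\<lambda>t. mellin_kernel (\<rho> J) s t + (\<Sum>j\<in>J. of_real (b j) * mellin_kernel (\<lambda>t. t powr p j) s t))"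
    by (auto simp: mellin_kernel_def \<rho>_def algebra_simps sum_distrib_left)
  have Is: "set_integrable lborel {0<..1} (\<lambda>t. \<Sum>j\<in>J. of_real (b j) * mellin_kernel (\<lambda>t. t powr p j) s t)"
    unfolding set_integrable_def scaleR_sum_right
    using Ip(1) by (intro Bochner_Integration.integrable_sum)
      (auto simp: set_integrable_def[symmetric] intro!: set_integrable_mult_right)
  have "(LINT t:{0<..1}|lborel. (\<Sum>j\<in>J. of_real (b j) * mellin_kernel (\<lambda>t. t powr p j) s t)) =
      (\<Sum>j\<in>J. (LINT t:{0<..1}|lborel. of_real (b j) * mellin_kernel (\<lambda>t. t powr p j) s t))"
    unfolding set_lebesgue_integral_def scaleR_sum_right
    using Ip(1) by (intro Bochner_Integration.integral_sum)
      (auto simp: set_integrable_def[symmetric] intro!: set_integrable_mult_right)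
  also have "\<dots> = (\<Sum>j\<in>J. of_real (b j) / (s + of_real (p j)))"
    by (intro sum.cong refl) (simp add: Ip)
  finally have Es: "(LINT t:{0<..1}|lborel. (\<Sum>j\<in>J. of_real (b j) * mellin_kernel (\<lambda>t. t powr p j) s t)) =
    (\<Sum>j\<in>J. of_real (b j) / (s + of_real (p j)))" .
  have U: "set_integrable lborel {0<..1} (mellin_kernel f s)"
    "(LINT t:{0<..1}|lborel. mellin_kernel f s t) =
      (LINT t:{0<..1}|lborel. mellin_kernel (\<rho> J) s t) + (\<Sum>j\<in>J. of_real (b j) / (s + of_real (p j)))"
    unfolding eq using set_integral_add[OF I1 Is] Es by auto
  have R: "set_integrable lborel {1<..} (mellin_kernel f s)"
    by (rule mellin_ray(1)[OF f c ray])
  have split: "{0<..} = {0<..1} \<union> {(1::real)<..}" by auto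
  show "set_integrable lborel {0<..} (mellin_kernel f s)"
    unfolding split by (intro set_integrable_Un U(1) R) auto
  show "(LINT t:{0<..}|lborel. mellin_kernel f s t) =
      (LINT t:{0<..1}|lborel. mellin_kernel (\<rho> J) s t) + (\<Sum>j\<in>J. of_real (b j) / (s + of_real (p j))) +
      (LINT t:{1<..}|lborel. mellin_kernel f s t)"
    unfolding split by (subst set_integral_Un) (use U R in auto)
qed

lemma mellin_exp:
  assumes "Re s > 0" "c > 0"
  shows "set_integrable lborel {0<..} (mellin_kernel (\<lambda>t. exp (- (c * t))) s)"
    and "(LINT t:{0<..}|lborel. mellin_kernel (\<lambda>t. exp (- (c * t))) s t) = Gamma s * of_real c powr (-s)"
proof -
  have int: "set_integrable lborel {0<..} (mellin_kernel (\<lambda>t. exp (- (c * t))) s)" if "c > 0" for c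
  proof -
    have "(\<lambda>t. complex_of_real t powr (s - 1) / of_real (exp (c * t))) absolutely_integrable_on {0<..}"
      using assms(1) that by (rule absolutely_integrable_Gamma_integral)
    hence "set_integrable lborel {0<..} (\<lambda>t. complex_of_real t powr (s - 1) / of_real (exp (c * t)))"
      by (rule set_integrable_lborel_absolutely_integrable_on) measurable
    thus ?thesis
      by (simp add: mellin_kernel_def[abs_def] exp_minus divide_inverse)
  qed
  show "set_integrable lborel {0<..} (mellin_kernel (\<lambda>t. exp (- (c * t))) s)"
    by (rule int) fact
  have "((\<lambda>t. of_real t powr (s - 1) / of_real (exp t)) has_integral Gamma s) {0<..}"
    by (rule Gamma_integral_complex') fact
  also have "(\<lambda>t. complex_of_real t powr (s - 1) / of_real (exp t)) = mellin_kernel (\<lambda>t. exp (- (1 * t))) s"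
    by (auto simp: mellin_kernel_def exp_minus divide_inverse)
  finally have "Gamma s = (LINT t:{0<..}|lborel. mellin_kernel (\<lambda>t. exp (- (1 * t))) s t)"
    using set_borel_integral_eq_integral(2)[OF int[of 1]] by (simp add: integral_unique)
  \<comment> \<open>Substituting \<open>c * x\<close> for the variable reduces the rate
    \<open>c\<close> to the rate 1; the Jacobian raises the exponent of \<open>c\<close> from
    \<open>s - 1\<close> to \<open>s\<close>.\<close>
  also have "\<dots> = c *\<^sub>R (LINT x|lborel. indicator {0<..} (c * x) *\<^sub>R mellin_kernel (\<lambda>t. exp (- (1 * t))) s (c * x))"
    unfolding set_lebesgue_integral_def
    using assms(2) by (subst lborel_integral_real_affine[where t = 0 and c = c]) auto
  also have "(\<lambda>x. indicator {0<..} (c * x) *\<^sub>R mellin_kernel (\<lambda>t. exp (- (1 * t))) s (c * x)) =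
     (\<lambda>x. of_real c powr (s - 1) * (indicator {0<..} x *\<^sub>R mellin_kernel (\<lambda>t. exp (- (c * t))) s x))"
  proof
    fix x
    show "indicator {0<..} (c * x) *\<^sub>R mellin_kernel (\<lambda>t. exp (- (1 * t))) s (c * x) =
     of_real c powr (s - 1) * (indicator {0<..} x *\<^sub>R mellin_kernel (\<lambda>t. exp (- (c * t))) s x)"
      using assms(2)
      by (cases "x > 0")
         (auto simp: mellin_kernel_def powr_times_real zero_less_mult_iff)
  qed
  also have "c *\<^sub>R (LINT x|lborel. of_real c powr (s - 1) * (indicator {0<..} x *\<^sub>R mellin_kernel (\<lambda>t. exp (- (c * t))) s x)) =
     of_real c powr s * (LINT t:{0<..}|lborel. mellin_kernel (\<lambda>t. exp (- (c * t))) s t)"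
    using assms(2) by (simp add: set_lebesgue_integral_def scaleR_conv_of_real powr_diff)
  finally show "(LINT t:{0<..}|lborel. mellin_kernel (\<lambda>t. exp (- (c * t))) s t) = Gamma s * of_real c powr (-s)"
    using assms(2) by (simp add: powr_minus field_simps)
qed

section \<open>The Dirichlet series as a Mellin transform\<close>

lemma summable_shifted_powr:
  fixes a \<sigma> :: real
  assumes "a > 0" "\<sigma> > 1"
  shows "summable (\<lambda>k. (real k + a) powr (-\<sigma>))"
proof (rule summable_comparison_test')
  show "summable (\<lambda>n. of_nat n powr (-\<sigma>) :: real)" using assms by (simp add: summable_real_powr_iff)
  show "norm ((real k + a) powr (-\<sigma>)) \<le> real k powr (-\<sigma>)" if "k \<ge> 1" for k
    using assms that by (auto intro!: powr_mono2')
qed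

text \<open>Multiplied by \<open>t\<close>, this is the generating function of the Bernoulli
  polynomials at \<open>a\<close>, in the variable \<open>-t\<close>.\<close>

definition hurwitz_kernel :: "real \<Rightarrow> real \<Rightarrow> real" where
  "hurwitz_kernel a t = exp (- (a * t)) / (1 - exp (- t))"

lemma measurable_hurwitz_kernel [measurable]: "hurwitz_kernel a \<in> borel_measurable borel"
  unfolding hurwitz_kernel_def[abs_def] by measurable

lemma hurwitz_kernel_sums:
  assumes "t > 0"
  shows "(\<lambda>k. exp (- ((real k + a) * t))) sums hurwitz_kernel a t"
proof -
  have "(\<lambda>k. exp (- (a * t)) * exp (- t) ^ k) sums (exp (- (a * t)) * (1 / (1 - exp (- t))))"
    using assms by (intro sums_mult geometric_sums) auto
  also have "(\<lambda>k. exp (- (a * t)) * exp (- t) ^ k) = (\<lambda>k. exp (- ((real k + a) * t)))"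
    by (auto simp: exp_of_nat_mult[symmetric] exp_add[symmetric] algebra_simps)
  finally show ?thesis by (simp add: hurwitz_kernel_def)
qed

text \<open>Termwise integration of the geometric series. The factor is written
  \<open>rGamma s\<close> because the reciprocal Gamma function is entire, so that this form
  survives continuation.\<close>

lemma mellin_hurwitz_kernel:
  assumes a: "a > 0" and s: "Re s > 1"
  shows "(\<Sum>k. complex_of_real (real k + a) powr (- s)) =
           rGamma s * (LINT t:{0<..}|lborel. mellin_kernel (hurwitz_kernel a) s t)"
proof -
  define f where "f k t = indicator {0<..} t *\<^sub>R mellin_kernel (\<lambda>t. exp (- ((real k + a) * t))) s t" for k t
  have int: "integrable lborel (f k)" for k
    unfolding f_def set_integrable_def[symmetric] using mellin_exp(1)[of s "real k + a"] a s by simp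
  have nf: "norm (f k t) = indicator {0<..} t *\<^sub>R (t powr (Re s - 1) * exp (- ((real k + a) * t)))" for k t
    by (auto simp: f_def norm_mellin_kernel indicator_def)
  \<comment> \<open>The norm of the integrand at \<open>s\<close> is the integrand at the real point
    \<open>Re s\<close>, so its integral is again a Gamma value. These values are summable over
    \<open>k\<close> because Re s > 1, which permits the interchange.\<close>
  have ni: "(LINT t|lborel. norm (f k t)) = Gamma (Re s) * (real k + a) powr (- Re s)" for k
  proof -
    have "complex_of_real (LINT t|lborel. norm (f k t)) =
       (LINT t|lborel. complex_of_real (norm (f k t)))" by simp
    also have "\<dots> = (LINT t:{0<..}|lborel. mellin_kernel (\<lambda>t. exp (- ((real k + a) * t))) (of_real (Re s)) t)"
      unfolding set_lebesgue_integral_def nf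
      by (intro Bochner_Integration.integral_cong refl)
         (auto simp: mellin_kernel_def indicator_def powr_of_real[symmetric])
    also have "\<dots> = Gamma (of_real (Re s)) * of_real (real k + a) powr (- of_real (Re s))"
      by (rule mellin_exp(2)) (use a s in auto)
    also have "\<dots> = of_real (Gamma (Re s) * (real k + a) powr (- Re s))"
      using a powr_of_real[of "real k + a" "- Re s"] by (simp add: Gamma_complex_of_real)
    finally show ?thesis by (simp only: of_real_eq_iff)
  qed
  have sm: "summable (\<lambda>k. norm (f k t))" for t
  proof (cases "t > 0")
    case True
    from sums_mult[OF hurwitz_kernel_sums[OF True, of a], of "t powr (Re s - 1)"]
    show ?thesis using True by (simp add: nf sums_iff)
  qed (simp add: nf)
  have "(\<lambda>k. LINT t|lborel. f k t) sums (LINT t|lborel. (\<Sum>k. f k t))"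
  proof (rule sums_integral[OF int])
    show "summable (\<lambda>k. LINT t|lborel. norm (f k t))"
      unfolding ni using a s by (intro summable_mult summable_shifted_powr) auto
  qed (use sm in auto)
  also have "(\<lambda>k. LINT t|lborel. f k t) = (\<lambda>k. Gamma s * of_real (real k + a) powr (-s))"
    unfolding f_def set_lebesgue_integral_def[symmetric]
    by (intro ext mellin_exp(2)) (use a s in auto)
  also have "(LINT t|lborel. (\<Sum>k. f k t)) = (LINT t:{0<..}|lborel. mellin_kernel (hurwitz_kernel a) s t)"
    unfolding set_lebesgue_integral_def
  proof (intro Bochner_Integration.integral_cong refl)
    fix t
    show "(\<Sum>k. f k t) = indicator {0<..} t *\<^sub>R mellin_kernel (hurwitz_kernel a) s t"
    proof (cases "t > 0")
      case True
      have "(\<lambda>k. f k t) sums (of_real t powr (s - 1) * of_real (hurwitz_kernel a t))"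
        using True sums_mult[OF sums_of_real[OF hurwitz_kernel_sums[OF True, of a]], of "of_real t powr (s - 1)"]
        by (simp add: f_def mellin_kernel_def)
      thus ?thesis using True by (simp add: sums_iff mellin_kernel_def)
    qed (simp add: f_def)
  qed
  finally have "(\<lambda>k. rGamma s * (Gamma s * of_real (real k + a) powr (-s))) sums
       (rGamma s * (LINT t:{0<..}|lborel. mellin_kernel (hurwitz_kernel a) s t))"
    by (rule sums_mult)
  moreover have "rGamma s * Gamma s = 1"
  proof -
    have "s \<notin> \<int>\<^sub>\<le>\<^sub>0" using s by (auto elim!: nonpos_Ints_cases)
    thus ?thesis by (simp add: rGamma_inverse_Gamma Gamma_eq_zero_iff)
  qed
  ultimately show ?thesis
    by (simp add: mult.assoc[symmetric] sums_iff)
qed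

section \<open>Continuation of the Hurwitz zeta function\<close>

text \<open>Each step divides \<open>g z - g 0\<close> by \<open>z\<close>, a removable singularity.
  The remainder factor is therefore holomorphic, hence bounded on smaller closed discs.\<close>

lemma holomorphic_on_ball_taylor_split:
  fixes f :: "complex \<Rightarrow> complex"
  assumes "f holomorphic_on ball 0 r"
  shows "\<exists>c g. g holomorphic_on ball 0 r \<and>
           (\<forall>z\<in>ball 0 r. f z = (\<Sum>j<N. c j * z ^ j) + z ^ N * g z)"
proof (induction N)
  case 0
  show ?case using assms by auto
next
  case (Suc N)
  then obtain c g where g: "g holomorphic_on ball 0 r"
    and eq: "\<And>z. z \<in> ball 0 r \<Longrightarrow> f z = (\<Sum>j<N. c j * z ^ j) + z ^ N * g z" by blast
  define g1 where "g1 z = (if z = 0 then deriv g 0 else (g z - g 0) / (z - 0))" for z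
  have "g1 holomorphic_on ball 0 r"
    unfolding g1_def by (rule pole_lemma_open[OF g]) auto
  moreover have "f z = (\<Sum>j<Suc N. (c(N := g 0)) j * z ^ j) + z ^ Suc N * g1 z" if "z \<in> ball 0 r" for z
  proof -
    have "g z = g 0 + z * g1 z" by (simp add: g1_def)
    thus ?thesis unfolding eq[OF that] by (simp add: algebra_simps)
  qed
  ultimately show ?case by blast
qed

text \<open>The exponents start at -1 because the kernel has a simple pole at 0. The other poles are
  nonzero multiples of 2 pi i, so radius 2 is small enough to avoid them and large enough to contain
  the closed unit disc.\<close>

lemma hurwitz_kernel_expansion:
  "\<exists>b D. \<forall>t. 0 < t \<longrightarrow> t \<le> 1 \<longrightarrow>
     \<bar>hurwitz_kernel a t - (\<Sum>j<N. b j * t powr (real j - 1))\<bar> \<le> D * t powr (real N - 1)"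
proof -
  \<comment> \<open>This is (1 - exp(-z)) / z with the singularity removed, spelled as a difference
    quotient to match \<open>pole_lemma_open\<close>.\<close>
  define k where "k z = (if z = 0 then deriv (\<lambda>z. - exp (- z)) 0
                          else (- exp (- z) - (- exp (- 0))) / (z - 0))" for z :: complex
  have "k holomorphic_on ball 0 2"
    unfolding k_def by (rule pole_lemma_open) (auto intro!: holomorphic_intros)
  moreover have knz: "k z \<noteq> 0" if "z \<in> ball 0 2" for z
  proof (cases "z = 0")
    case True
    have "((\<lambda>z::complex. - exp (- z)) has_field_derivative 1) (at 0)"
      by (auto intro!: derivative_eq_intros)
    thus ?thesis using True by (simp add: k_def DERIV_imp_deriv)
  next
    case False
    have "exp (- z) \<noteq> 1"
    proof
      assume "exp (- z) = 1"
      then obtain n :: int where n: "Re z = 0" "- Im z = of_int (2 * n) * pi"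
        unfolding exp_eq_1 by auto
      have "\<bar>Im z\<bar> < 2" using that abs_Im_le_cmod[of z] by simp
      moreover have "\<bar>Im z\<bar> = 2 * real_of_int \<bar>n\<bar> * pi" using n(2) by (simp add: abs_mult flip: abs_minus_cancel[of "Im z"])
      moreover have "n \<noteq> 0" using n False by (auto simp: complex_eq_iff)
      hence "1 * 1 \<le> real_of_int \<bar>n\<bar> * pi" using pi_gt3 by (intro mult_mono) auto
      ultimately show False by simp
    qed
    thus ?thesis using False by (simp add: k_def)
  qed
  ultimately have "(\<lambda>z. exp (- (of_real a * z)) / k z) holomorphic_on ball 0 2"
    by (intro holomorphic_intros) auto
  from holomorphic_on_ball_taylor_split[OF this, of N]
  obtain c g where g: "g holomorphic_on ball 0 2"
    and eq: "\<And>z. z \<in> ball 0 2 \<Longrightarrow> exp (- (of_real a * z)) / k z = (\<Sum>j<N. c j * z ^ j) + z ^ N * g z"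
    by blast
  have "compact (g ` cball 0 1)"
    by (intro compact_continuous_image holomorphic_on_imp_continuous_on holomorphic_on_subset[OF g]) auto
  then obtain D where D: "\<And>z. z \<in> cball 0 1 \<Longrightarrow> norm (g z) \<le> D"
    by (metis bounded_iff compact_imp_bounded image_eqI)
  \<comment> \<open>The coefficients arise as complex numbers; as the kernel is real, their real
    parts serve equally well.\<close>
  have "\<bar>hurwitz_kernel a t - (\<Sum>j<N. Re (c j) * t powr (real j - 1))\<bar> \<le> D * t powr (real N - 1)"
    if t: "0 < t" "t \<le> 1" for t
  proof -
    have "complex_of_real (t * hurwitz_kernel a t) = exp (- (of_real a * of_real t)) / k (of_real t)"
      using t by (simp add: k_def hurwitz_kernel_def exp_of_real[symmetric])
    also have "\<dots> = (\<Sum>j<N. c j * of_real t ^ j) + of_real t ^ N * g (of_real t)"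
      using t by (intro eq) auto
    finally have "t * hurwitz_kernel a t = Re ((\<Sum>j<N. c j * of_real t ^ j) + of_real t ^ N * g (of_real t))"
      by (metis Re_complex_of_real)
    also have "\<dots> = (\<Sum>j<N. Re (c j) * t ^ j) + t ^ N * Re (g (of_real t))"
      by (simp flip: of_real_power)
    finally have "hurwitz_kernel a t = (\<Sum>j<N. Re (c j) * (t ^ j / t)) + t ^ N / t * Re (g (of_real t))"
      using t by (simp add: field_simps sum_distrib_left sum_divide_distrib)
    hence "hurwitz_kernel a t - (\<Sum>j<N. Re (c j) * t powr (real j - 1)) = t powr (real N - 1) * Re (g (of_real t))"
      using t by (simp add: powr_diff powr_realpow)
    moreover have "\<bar>Re (g (of_real t))\<bar> \<le> D"
      using t by (intro order.trans[OF abs_Re_le_cmod D]) auto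
    ultimately show ?thesis using t
      by (simp add: abs_mult mult.commute mult_right_mono)
  qed
  thus ?thesis by (intro exI[of _ "\<lambda>j. Re (c j)"] exI[of _ D]) simp
qed

lemma hurwitz_kernel_bound:
  assumes "t \<ge> 1"
  shows "\<bar>hurwitz_kernel a t\<bar> \<le> 1 / (1 - exp (- 1)) * exp (- (a * t))"
proof -
  have "1 - exp (-1) > (0::real)" by simp
  moreover have "1 - exp (- t) \<ge> 1 - exp (-1)" using assms by simp
  ultimately show ?thesis
    by (auto simp: hurwitz_kernel_def abs_mult intro!: divide_left_mono mult_pos_pos)
qed

lemma hurwitz_zeta_series_continuation_strip:
  assumes a: "a > 0"
  shows "\<exists>F. F holomorphic_on ({s. Re s > 1 - real N} - {1}) \<and>
           (\<forall>s. 1 < Re s \<longrightarrow> F s = (\<Sum>k. complex_of_real (real k + a) powr (- s)))"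
proof -
  define f where "f = hurwitz_kernel a"
  obtain b D where bD: "\<And>t. 0 < t \<Longrightarrow> t \<le> 1 \<Longrightarrow>
     \<bar>f t - (\<Sum>j<N. b j * t powr (real j - 1))\<bar> \<le> D * t powr (real N - 1)"
    using hurwitz_kernel_expansion[of a N] unfolding f_def by blast
  have f: "f \<in> borel_measurable borel" unfolding f_def by measurable
  have ray: "\<bar>f t\<bar> \<le> 1 / (1 - exp (- 1)) * exp (- (a * t))" if "1 < t" for t
    unfolding f_def by (rule hurwitz_kernel_bound) (use that in auto)
  define r where "r t = f t - (\<Sum>j<N. b j * t powr (real j - 1))" for t
  have r: "r \<in> borel_measurable borel" unfolding r_def[abs_def] using f by measurable
  define A where "A s = (LINT t:{0<..1}|lborel. mellin_kernel r s t)" for s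
  define B where "B s = (LINT t:{1<..}|lborel. mellin_kernel f s t)" for s
  \<comment> \<open>\<open>E j s\<close> stands for \<open>rGamma s / (s + j - 1)\<close>. For
    \<open>j > 0\<close> the zero of \<open>rGamma\<close> at \<open>1 - j\<close> cancels the pole,
    and the pochhammer form shows this; only \<open>j = 0\<close> keeps its pole, at 1.\<close>
  define E :: "nat \<Rightarrow> complex \<Rightarrow> complex" where
    "E j s = (if j = 0 then rGamma s / (s - 1) else pochhammer s (j - 1) * rGamma (s + of_nat j))" for j s
  define F where "F s = rGamma s * (A s + B s) + (\<Sum>j<N. of_real (b j) * E j s)" for s
  have "A holomorphic_on {s. Re s > - (real N - 1)}"
    unfolding A_def by (rule mellin_unit_interval(2)[OF r]) (use bD in \<open>auto simp: r_def\<close>)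
  hence A: "A holomorphic_on ({s. Re s > 1 - real N} - {1})"
    by (rule holomorphic_on_subset) auto
  have "B holomorphic_on UNIV"
    unfolding B_def by (rule mellin_ray(2)[OF f a ray])
  hence B: "B holomorphic_on ({s. Re s > 1 - real N} - {1})"
    by (rule holomorphic_on_subset) auto
  have E: "E j holomorphic_on ({s. Re s > 1 - real N} - {1})" for j
  proof (cases "j = 0")
    case True
    thus ?thesis unfolding E_def[abs_def] by (auto intro!: holomorphic_intros)
  next
    case False
    thus ?thesis unfolding E_def[abs_def] by (auto intro!: holomorphic_intros)
  qed
  have "F holomorphic_on ({s. Re s > 1 - real N} - {1})"
    unfolding F_def[abs_def] by (intro holomorphic_intros A B E)
  moreover have "F s = (\<Sum>k. complex_of_real (real k + a) powr (- s))" if s: "1 < Re s" for s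
  proof -
    have Ej: "rGamma s * (of_real (b j) / (s + of_real (real j - 1))) = of_real (b j) * E j s" for j
    proof (cases j)
      case 0
      thus ?thesis by (simp add: E_def)
    next
      case (Suc i)
      have "s + of_nat i \<noteq> 0" using s by (auto simp: complex_eq_iff)
      moreover have "rGamma s = (s + of_nat i) * pochhammer s i * rGamma (s + of_nat j)"
        using pochhammer_rGamma[of s j] by (simp only: Suc pochhammer_rec')
      ultimately show ?thesis using Suc by (simp add: E_def field_simps)
    qed
    have "(\<Sum>k. complex_of_real (real k + a) powr (- s)) =
            rGamma s * (LINT t:{0<..}|lborel. mellin_kernel f s t)"
      unfolding f_def by (rule mellin_hurwitz_kernel[OF a s])
    also have "(LINT t:{0<..}|lborel. mellin_kernel f s t) =
        A s + (\<Sum>j<N. of_real (b j) / (s + of_real (real j - 1))) + B s"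
      unfolding A_def B_def r_def
      by (rule mellin_expansion(2)[OF f a _ ray bD]) (use s in auto)
    also have "rGamma s * \<dots> = rGamma s * (A s + B s) + (\<Sum>j<N. rGamma s * (of_real (b j) / (s + of_real (real j - 1))))"
      by (simp add: algebra_simps sum_distrib_left)
    also have "\<dots> = F s" unfolding F_def Ej ..
    finally show ?thesis ..
  qed
  ultimately show ?thesis by blast
qed

lemma holomorphic_eq_punctured_half_plane:
  assumes "F holomorphic_on ({s. Re s > x} - {1})" "G holomorphic_on ({s. Re s > x} - {1})"
    and "\<And>s. Re s > 1 \<Longrightarrow> F s = G s" and "Re s > x" "s \<noteq> 1" "x \<le> 1"
  shows "F s = G s"
proof (rule analytic_continuation_open[of "{s. Re s > 1}" "{s. Re s > x} - {1}" F G])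
  show "open ({s. Re s > x} - {1})" by (intro open_Diff open_halfspace_Re_gt) auto
  show "connected ({s. Re s > x} - {1})"
    by (rule connected_open_delete) (auto intro: open_halfspace_Re_gt convex_connected convex_halfspace_Re_gt)
  show "{s. Re s > 1} \<noteq> {}" by (auto intro: exI[of _ 2])
qed (use assms open_halfspace_Re_gt in auto)

lemma hurwitz_zeta_series_continuation:
  assumes a: "a > 0"
  shows "\<exists>f. f holomorphic_on (- {1}) \<and> f 1 = 0 \<and>
           (\<forall>s. 1 < Re s \<longrightarrow> f s = (\<Sum>k. complex_of_real (real k + a) powr (- s)))"
proof -
  from hurwitz_zeta_series_continuation_strip[OF a]
  obtain F where F: "\<And>N. F N holomorphic_on ({s. Re s > 1 - real N} - {1})"
    and Fs: "\<And>N s. 1 < Re s \<Longrightarrow> F N s = (\<Sum>k. complex_of_real (real k + a) powr (- s))"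
    by metis
  \<comment> \<open>The index of a strip that contains \<open>s\<close>; the added 1 makes the
    inequality strict.\<close>
  define N where "N s = nat \<lceil>1 - Re s\<rceil> + 1" for s
  define f where "f s = (if s = 1 then 0 else F (N s) s)" for s
  have N: "Re s > 1 - real (N s)" for s unfolding N_def by linarith
  have eq: "f s = F n s" if "Re s > 1 - real n" "s \<noteq> 1" for s n
  proof -
    \<comment> \<open>Two continuations are compared on the smaller of their two half planes, which
      both contain.\<close>
    define k where "k = min n (N s)"
    have "F n s = F (N s) s"
    proof (rule holomorphic_eq_punctured_half_plane[where x = "1 - real k" and F = "F n" and G = "F (N s)"])
      show "F n holomorphic_on ({s. Re s > 1 - real k} - {1})"
        by (rule holomorphic_on_subset[OF F]) (auto simp: k_def)
      show "F (N s) holomorphic_on ({s. Re s > 1 - real k} - {1})"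
        by (rule holomorphic_on_subset[OF F]) (auto simp: k_def)
    qed (use that N[of s] in \<open>auto simp: Fs k_def min_def\<close>)
    thus ?thesis using that by (simp add: f_def)
  qed
  have op: "open (- {1::complex})" by auto
  have "f holomorphic_on (- {1})"
    unfolding holomorphic_on_open[OF op]
  proof
    fix s :: complex assume s: "s \<in> - {1}"
    let ?S = "{w. Re w > 1 - real (N s)} - {1}"
    have "f holomorphic_on ?S \<longleftrightarrow> F (N s) holomorphic_on ?S"
      by (intro holomorphic_cong refl eq) auto
    hence "f holomorphic_on ?S" using F by simp
    moreover have "open ?S" by (intro open_Diff open_halfspace_Re_gt) auto
    moreover have "s \<in> ?S" using s N[of s] by auto
    ultimately show "\<exists>f'. (f has_field_derivative f') (at s)"
      by (auto simp: holomorphic_on_open)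
  qed
  moreover have "f s = (\<Sum>k. complex_of_real (real k + a) powr (- s))" if "1 < Re s" for s
  proof -
    have "s \<noteq> 1" using that by auto
    thus ?thesis using eq[of 0 s] Fs[OF that, of 0] that by simp
  qed
  ultimately show ?thesis by (intro exI[of _ f]) (auto simp: f_def)
qed

text \<open>Existence comes from the glued continuation and uniqueness from the identity theorem,
  the value at 1 being prescribed; together they unlock the definite description.\<close>

lemma
  assumes a: "a > 0"
  shows holomorphic_hurwitz_zeta: "hurwitz_zeta a holomorphic_on (- {1})"
    and hurwitz_zeta_series: "1 < Re s \<Longrightarrow> hurwitz_zeta a s = (\<Sum>k. complex_of_real (real k + a) powr (- s))"
proof -
  define P where "P f \<longleftrightarrow> f holomorphic_on (- {1}) \<and> f 1 = 0 \<and>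
           (\<forall>s. 1 < Re s \<longrightarrow> f s = (\<Sum>k. complex_of_real (real k + a) powr (- s)))" for f
  have ex: "\<exists>f. P f" unfolding P_def by (rule hurwitz_zeta_series_continuation[OF a])
  have uniq: "f = g" if "P f" "P g" for f g
  proof
    fix s :: complex
    show "f s = g s"
    proof (cases "s = 1")
      case True
      thus ?thesis using that by (simp add: P_def)
    next
      case False
      \<comment> \<open>Any abscissa that is at most 1 and strictly below \<open>Re s\<close> will
        do.\<close>
      define x where "x = min 1 (Re s - 1)"
      show ?thesis
        by (rule holomorphic_eq_punctured_half_plane[where x = x])
           (use that False in \<open>auto simp: P_def x_def intro: holomorphic_on_subset\<close>)
    qed
  qed
  have "hurwitz_zeta a = (THE f. P f)"
    using ex unfolding hurwitz_zeta_def P_def by simp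
  moreover have "P (THE f. P f)" by (rule theI'[of P]) (use ex uniq in blast)
  ultimately have "P (hurwitz_zeta a)" by simp
  thus "hurwitz_zeta a holomorphic_on (- {1})"
    and "1 < Re s \<Longrightarrow> hurwitz_zeta a s = (\<Sum>k. complex_of_real (real k + a) powr (- s))"
    unfolding P_def by auto
qed

section \<open>The Fourier series of the second Bernoulli polynomial\<close>

lemma summable_inverse_Suc_squares: "summable (\<lambda>n. 1 / (real n + 1)\<^sup>2)"
  using inverse_squares_sums by (auto simp: sums_iff add_ac)

text \<open>1 - cis y has modulus 2 sin(y/2) and argument (y - pi)/2, which lies strictly between
  -pi/2 and pi/2 and so on the principal branch.\<close>

lemma Ln_one_minus_cis:
  assumes "0 < y" "y < 2 * pi"
  shows "1 - cis y \<notin> \<real>\<^sub>\<le>\<^sub>0" "Im (Ln (1 - cis y)) = (y - pi) / 2"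
proof -
  have s: "sin (y / 2) > 0" using assms by (intro sin_gt_zero) auto
  have c: "cos y = 1 - 2 * (sin (y / 2))\<^sup>2"
    using cos_double_sin[of "y / 2"] by simp
  show "1 - cis y \<notin> \<real>\<^sub>\<le>\<^sub>0"
    using s c by (auto simp: complex_nonpos_Reals_iff)
  have "Ln (1 - cis y) = Complex (ln (2 * sin (y / 2))) ((y - pi) / 2)"
  proof (rule Ln_unique)
    have "cos ((y - pi) / 2) = sin (y / 2)" "sin ((y - pi) / 2) = - cos (y / 2)"
      by (simp_all add: diff_divide_distrib sin_diff cos_diff)
    moreover have "sin y = 2 * sin (y / 2) * cos (y / 2)" using sin_double[of "y / 2"] by simp
    ultimately show "exp (Complex (ln (2 * sin (y / 2))) ((y - pi) / 2)) = 1 - cis y"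
      using s by (simp add: exp_eq_polar complex_eq_iff c power2_eq_square)
  qed (use assms in auto)
  thus "Im (Ln (1 - cis y)) = (y - pi) / 2" by simp
qed

text \<open>The imaginary part of the series of -Ln(1 - z) at z = r cis y.\<close>

lemma sums_sin_power_over:
  assumes "\<bar>r\<bar> < 1"
  shows "(\<lambda>n. r ^ Suc n * sin ((real n + 1) * y) / (real n + 1)) sums (- Im (Ln (1 - of_real r * cis y)))"
proof -
  have "(\<lambda>n. - ((- (- (of_real r * cis y))) ^ n) / of_nat n) sums ln (1 + (- (of_real r * cis y)))"
    by (rule Ln_series') (use assms in \<open>simp add: norm_mult\<close>)
  hence "(\<lambda>n. - ((of_real r * cis y) ^ n / of_nat n)) sums ln (1 - of_real r * cis y)" by simp
  \<comment> \<open>The term of index 0 is a division by zero, hence 0, so the series may start at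
    1.\<close>
  hence "(\<lambda>n. - ((of_real r * cis y) ^ Suc n / of_nat (Suc n))) sums ln (1 - of_real r * cis y)"
    by (subst sums_Suc_iff) simp
  from sums_Im[OF sums_minus[OF this]]
  have "(\<lambda>n. Im ((of_real r * cis y) ^ Suc n / of_nat (Suc n))) sums (- Im (Ln (1 - of_real r * cis y)))"
    by simp
  also have "(\<lambda>n. Im ((of_real r * cis y) ^ Suc n / of_nat (Suc n))) =
       (\<lambda>n. r ^ Suc n * sin ((real n + 1) * y) / (real n + 1))"
  proof
    fix n
    have "(of_real r * cis y) ^ Suc n / of_nat (Suc n) = of_real (r ^ Suc n / (real n + 1)) * cis (real (Suc n) * y)"
      unfolding power_mult_distrib Complex.DeMoivre by (simp add: add_ac)
    thus "Im ((of_real r * cis y) ^ Suc n / of_nat (Suc n)) = r ^ Suc n * sin ((real n + 1) * y) / (real n + 1)"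
      by (simp add: add_ac del: power_Suc of_real_power of_real_mult of_real_divide)
  qed
  finally show ?thesis .
qed

lemma has_field_derivative_suminf:
  fixes f f' :: "nat \<Rightarrow> real \<Rightarrow> real"
  assumes "\<And>n x. (f n has_field_derivative f' n x) (at x)"
    and "\<And>n x. \<bar>f' n x\<bar> \<le> M n" "summable M" "summable (\<lambda>n. f n x0)"
  shows "((\<lambda>x. \<Sum>n. f n x) has_field_derivative (\<Sum>n. f' n x)) (at x)"
  by (rule has_field_derivative_series'(2)[where S = UNIV and ?x0.0 = x0])
     (use assms in \<open>auto intro!: Weierstrass_m_test'\<close>)

lemma abs_mult_divide_le:
  fixes q s w :: real
  assumes "q \<ge> 0" "\<bar>s\<bar> \<le> 1" "w \<ge> 1"
  shows "\<bar>q * s / w\<bar> \<le> q"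
proof -
  have "\<bar>q * s / w\<bar> = q * \<bar>s\<bar> / w" using assms by (simp add: abs_mult)
  also have "\<dots> \<le> q * 1 / 1" using assms by (intro frac_le mult_left_mono) auto
  finally show ?thesis by simp
qed

text \<open>
  Abel summation: for \<open>r < 1\<close> the series with weights \<open>r ^ n\<close> is the integral of the imaginary part
  of a logarithm, which stays bounded as \<open>r \<rightarrow> 1\<close>.
\<close>

lemma sums_cos_over_square:
  assumes x: "0 \<le> x" "x \<le> 2 * pi"
  shows "(\<lambda>n. cos ((real n + 1) * x) / (real n + 1)\<^sup>2) sums (pi\<^sup>2 / 6 - pi * x / 2 + x\<^sup>2 / 4)"
proof -
  define c where "c r y = (\<Sum>n. r ^ Suc n * cos ((real n + 1) * y) / (real n + 1)\<^sup>2)" for r y :: real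
  define u where "u r y = - Im (Ln (1 - of_real r * cis y))" for r y :: real
  \<comment> \<open>Radii in [0,1) tending to 1; a sequence, because dominated convergence is
    applied along one.\<close>
  define R where "R k = 1 - 1 / (real k + 2)" for k
  have R: "0 \<le> R k" "R k < 1" for k by (auto simp: R_def field_simps)
  have R1: "R \<longlonglongrightarrow> 1" unfolding R_def by real_asymp
  have der: "((c r) has_field_derivative (- u r y)) (at y)" if r: "0 \<le> r" "r < 1" for r y
  proof -
    have "((c r) has_field_derivative (\<Sum>n. - (r ^ Suc n * sin ((real n + 1) * y) / (real n + 1)))) (at y)"
      unfolding c_def[abs_def]
    proof (rule has_field_derivative_suminf[where M = "\<lambda>n. r ^ n" and ?x0.0 = "pi/2"])
      fix n y
      show "((\<lambda>y. r ^ Suc n * cos ((real n + 1) * y) / (real n + 1)\<^sup>2) has_field_derivative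
              - (r ^ Suc n * sin ((real n + 1) * y) / (real n + 1))) (at y)"
      proof -
        have "((\<lambda>y. r ^ Suc n * cos (N * y) / N\<^sup>2) has_field_derivative - (r ^ Suc n * sin (N * y) / N)) (at y)"
          if "N \<noteq> 0" for N :: real
          using that by (auto intro!: derivative_eq_intros simp: power2_eq_square)
        from this[of "real n + 1"] show ?thesis by (simp add: add_eq_0_iff)
      qed
      have "r ^ Suc n \<le> r ^ n" using r by (intro power_decreasing) auto
      thus "\<bar>- (r ^ Suc n * sin ((real n + 1) * y) / (real n + 1))\<bar> \<le> r ^ n"
        using r by (simp only: abs_minus_cancel) (intro order.trans[OF abs_mult_divide_le]; simp)
    next
      show "summable (\<lambda>n. r ^ n)" using r by simp
      show "summable (\<lambda>n. r ^ Suc n * cos ((real n + 1) * (pi/2)) / (real n + 1)\<^sup>2)"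
      proof (rule summable_comparison_test'[OF summable_inverse_Suc_squares])
        fix n
        have "\<bar>r ^ Suc n\<bar> * \<bar>cos ((real n + 1) * (pi/2))\<bar> \<le> 1"
          using r by (intro mult_le_one) (auto simp del: power_Suc intro: power_le_one)
        thus "norm (r ^ Suc n * cos ((real n + 1) * (pi/2)) / (real n + 1)\<^sup>2) \<le> 1 / (real n + 1)\<^sup>2"
          by (simp add: abs_mult divide_right_mono)
      qed
    qed
    also have "(\<Sum>n. - (r ^ Suc n * sin ((real n + 1) * y) / (real n + 1))) = - u r y"
      using sums_minus[OF sums_sin_power_over[of r y]] r unfolding u_def by (simp add: sums_iff)
    finally show ?thesis .
  qed
  have int: "((\<lambda>y. - u (R k) y) has_integral (c (R k) x - c (R k) 0)) {0..x}" for k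
    using x der[OF R] by (intro fundamental_theorem_of_calculus)
      (auto simp flip: has_real_derivative_iff_has_vector_derivative intro: has_field_derivative_at_within)
  \<comment> \<open>The limit is discontinuous: at 0 and 2 pi the logarithm has a positive real
    argument for every radius, so its imaginary part is 0 there.\<close>
  define g where "g y = (if 0 < y \<and> y < 2 * pi then (y - pi) / 2 else 0)" for y
  have "(\<lambda>k. integral {0..x} (\<lambda>y. - u (R k) y)) \<longlonglongrightarrow> integral {0..x} g"
  \<comment> \<open>The principal argument never exceeds pi in modulus.\<close>
  proof (rule dominated_convergence(2)[where h = "\<lambda>_. pi"])
    show "(\<lambda>y. - u (R k) y) integrable_on {0..x}" for k using int by blast
    show "norm (- u (R k) y) \<le> pi" if "y \<in> {0..x}" for k y
    proof -
      have "norm (complex_of_real (R k) * cis y) < 1" using R[of k] by (simp add: norm_mult)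
      hence "1 - of_real (R k) * cis y \<noteq> 0" by auto
      from mpi_less_Im_Ln[OF this] Im_Ln_le_pi[OF this] show ?thesis unfolding u_def by simp
    qed
    show "(\<lambda>k. - u (R k) y) \<longlonglongrightarrow> g y" if y: "y \<in> {0..x}" for y
    proof (cases "0 < y \<and> y < 2 * pi")
      case True
      have "(\<lambda>k. Im (Ln (1 - of_real (R k) * cis y))) \<longlonglongrightarrow> Im (Ln (1 - of_real 1 * cis y))"
        using Ln_one_minus_cis(1)[of y] True by (intro tendsto_intros R1) auto
      thus ?thesis using True Ln_one_minus_cis(2)[of y] by (simp add: g_def u_def)
    next
      case False
      hence "y = 0 \<or> y = 2 * pi" using x y by auto
      moreover have "Im (Ln (1 - of_real (R k))) = 0" for k
        using R[of k] by (subst of_real_1[symmetric], subst of_real_diff[symmetric], subst Ln_of_real) auto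
      ultimately have "u (R k) y = 0" for k
        by (auto simp: u_def)
      moreover have "g y = 0" using False unfolding g_def by (simp only: if_False)
      ultimately show ?thesis by simp
    qed
  qed auto
  also have "(\<lambda>k. integral {0..x} (\<lambda>y. - u (R k) y)) = (\<lambda>k. c (R k) x - c (R k) 0)"
    by (intro ext integral_unique int)
  also have "integral {0..x} g = x\<^sup>2 / 4 - pi * x / 2"
  proof -
    have "((\<lambda>y. (y - pi) / 2) has_integral ((x\<^sup>2 / 4 - pi * x / 2) - (0\<^sup>2 / 4 - pi * 0 / 2))) {0..x}"
      using x by (intro fundamental_theorem_of_calculus)
        (auto simp flip: has_real_derivative_iff_has_vector_derivative intro!: derivative_eq_intros simp: field_simps)
    hence "(g has_integral ((x\<^sup>2 / 4 - pi * x / 2) - (0\<^sup>2 / 4 - pi * 0 / 2))) {0..x}"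
      by (rule has_integral_spike[of "{0, 2 * pi}", rotated 2]) (use x in \<open>auto simp: g_def\<close>)
    thus ?thesis by (simp add: integral_unique)
  qed
  finally have lim: "(\<lambda>k. c (R k) x - c (R k) 0) \<longlonglongrightarrow> x\<^sup>2 / 4 - pi * x / 2" .
  have clim: "(\<lambda>k. c (R k) y) \<longlonglongrightarrow> (\<Sum>n. cos ((real n + 1) * y) / (real n + 1)\<^sup>2)" for y
  proof -
    have "(\<lambda>k. \<Sum>n. R k ^ Suc n * cos ((real n + 1) * y) / (real n + 1)\<^sup>2) \<longlonglongrightarrow>
            (\<Sum>n. 1 ^ Suc n * cos ((real n + 1) * y) / (real n + 1)\<^sup>2)"
    proof (rule tannerys_theorem[where M = "\<lambda>n. 1 / (real n + 1)\<^sup>2", THEN conjunct2, THEN conjunct2])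
      show "(\<lambda>k. R k ^ Suc n * cos ((real n + 1) * y) / (real n + 1)\<^sup>2) \<longlonglongrightarrow>
            1 ^ Suc n * cos ((real n + 1) * y) / (real n + 1)\<^sup>2" for n
        by (intro tendsto_intros R1) (auto simp: add_eq_0_iff)
      have "norm (R k ^ Suc n * cos ((real n + 1) * y) / (real n + 1)\<^sup>2) \<le> 1 / (real n + 1)\<^sup>2" for n k
      proof -
        have "\<bar>R k ^ Suc n\<bar> * \<bar>cos ((real n + 1) * y)\<bar> \<le> 1"
          using R[of k] by (intro mult_le_one) (auto simp del: power_Suc intro: power_le_one)
        thus ?thesis by (simp add: abs_mult divide_right_mono)
      qed
      thus "\<forall>\<^sub>F (n, k) in sequentially \<times>\<^sub>F sequentially.
         norm (R k ^ Suc n * cos ((real n + 1) * y) / (real n + 1)\<^sup>2) \<le> 1 / (real n + 1)\<^sup>2"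
        by (intro always_eventually) auto
    qed (use summable_inverse_Suc_squares in auto)
    thus ?thesis by (simp add: c_def)
  qed
  \<comment> \<open>Integration fixes the sum only relative to its value at 0, which is the Basel
    sum.\<close>
  have "(\<Sum>n. cos ((real n + 1) * x) / (real n + 1)\<^sup>2) - (\<Sum>n. cos ((real n + 1) * 0) / (real n + 1)\<^sup>2)
      = x\<^sup>2 / 4 - pi * x / 2"
    using LIMSEQ_unique[OF tendsto_diff[OF clim[of x] clim[of 0]] lim] .
  moreover have "(\<Sum>n. cos ((real n + 1) * 0) / (real n + 1)\<^sup>2) = pi\<^sup>2 / 6"
    using inverse_squares_sums by (simp add: sums_iff add_ac)
  moreover have "summable (\<lambda>n. cos ((real n + 1) * x) / (real n + 1)\<^sup>2)"
    by (rule summable_comparison_test'[OF summable_inverse_Suc_squares]) (simp add: divide_right_mono)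
  ultimately show ?thesis by (simp add: sums_iff)
qed

section \<open>Partial fractions of the kernel\<close>

lemma summable_over_Suc_squares:
  fixes f :: "nat \<Rightarrow> real"
  assumes "\<And>n. \<bar>f n\<bar> \<le> C / (real n + 1)\<^sup>2"
  shows "summable f"
  by (rule summable_comparison_test'[OF summable_mult[OF summable_inverse_Suc_squares, of C]])
     (use assms in auto)

text \<open>Sums run from 0, so index \<open>n\<close> carries the frequency 2 pi (n + 1).\<close>

definition circ_freq :: "nat \<Rightarrow> real" where "circ_freq n = 2 * pi * (real n + 1)"

lemma circ_freq_ge: "circ_freq n \<ge> real n + 1" "circ_freq n \<ge> 1" "circ_freq n > 0"
proof -
  have "1 * (real n + 1) \<le> (2 * pi) * (real n + 1)" using pi_gt3 by (intro mult_right_mono) auto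
  thus "circ_freq n \<ge> real n + 1" by (simp add: circ_freq_def)
  thus "circ_freq n \<ge> 1" "circ_freq n > 0" by auto
qed

lemma circ_freq_coeff_bound:
  assumes "\<bar>s\<bar> \<le> 1"
  shows "\<bar>4 * s / (circ_freq n ^ i * (t\<^sup>2 + (circ_freq n)\<^sup>2))\<bar> \<le> 4 / (real n + 1)\<^sup>2"
proof -
  have le: "1 * (real n + 1)\<^sup>2 \<le> circ_freq n ^ i * (t\<^sup>2 + (circ_freq n)\<^sup>2)"
    using circ_freq_ge[of n] by (intro mult_mono add_increasing power_mono one_le_power) auto
  hence "\<bar>4 * s / (circ_freq n ^ i * (t\<^sup>2 + (circ_freq n)\<^sup>2))\<bar> =
      4 * \<bar>s\<bar> / (circ_freq n ^ i * (t\<^sup>2 + (circ_freq n)\<^sup>2))"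
    using circ_freq_ge(3)[of n] by (simp add: abs_mult)
  also have "\<dots> \<le> 4 * 1 / (1 * (real n + 1)\<^sup>2)"
    using assms le by (intro frac_le) auto
  finally show ?thesis by simp
qed

lemma circ_freq_coeff_bound':
  assumes "\<bar>s\<bar> \<le> 1" "i \<ge> 2"
  shows "\<bar>4 * s / circ_freq n ^ i\<bar> \<le> 4 / (real n + 1)\<^sup>2"
proof -
  obtain k where "i = k + 2" using assms(2) by (metis add.commute le_Suc_ex)
  thus ?thesis using circ_freq_coeff_bound[OF assms(1), of n k 0]
    by (simp add: power2_eq_square mult_ac)
qed

text \<open>The preceding Fourier series rescaled by x = 2 pi a; the sum is the second Bernoulli
  polynomial.\<close>

lemma sums_cos_over_circ_freq_square:
  assumes "0 \<le> a" "a \<le> 1"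
  shows "(\<lambda>n. 4 * cos (circ_freq n * a) / (circ_freq n)\<^sup>2) sums (1 / 6 - a + a\<^sup>2)"
proof -
  have "2 * pi * a \<le> 2 * pi * 1" using assms by (intro mult_left_mono) auto
  hence "(\<lambda>n. 1 / pi\<^sup>2 * (cos ((real n + 1) * (2 * pi * a)) / (real n + 1)\<^sup>2)) sums
        (1 / pi\<^sup>2 * (pi\<^sup>2 / 6 - pi * (2 * pi * a) / 2 + (2 * pi * a)\<^sup>2 / 4))"
    using assms by (intro sums_mult sums_cos_over_square) auto
  also have "(\<lambda>n. 1 / pi\<^sup>2 * (cos ((real n + 1) * (2 * pi * a)) / (real n + 1)\<^sup>2)) =
     (\<lambda>n. 4 * cos (circ_freq n * a) / (circ_freq n)\<^sup>2)"
  proof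
    fix n
    have 1: "circ_freq n * a = (real n + 1) * (2 * pi * a)" by (simp add: circ_freq_def)
    have 2: "(circ_freq n)\<^sup>2 = 4 * (pi\<^sup>2 * (real n + 1)\<^sup>2)" by (simp add: circ_freq_def power_mult_distrib)
    show "1 / pi\<^sup>2 * (cos ((real n + 1) * (2 * pi * a)) / (real n + 1)\<^sup>2) =
        4 * cos (circ_freq n * a) / (circ_freq n)\<^sup>2"
      unfolding 1 2 by simp
  qed
  also have "1 / pi\<^sup>2 * (pi\<^sup>2 / 6 - pi * (2 * pi * a) / 2 + (2 * pi * a)\<^sup>2 / 4) = 1 / 6 - a + a\<^sup>2"
    by (simp add: field_simps power2_eq_square)
  finally show ?thesis .
qed

text \<open>The partial fraction series after \<open>i + 1\<close> steps of long division in t^2, up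
  to sign. Even \<open>i = 0\<close> has one division done already, which makes the series
  absolutely convergent.\<close>

definition sine_series :: "nat \<Rightarrow> real \<Rightarrow> real \<Rightarrow> real" where
  "sine_series i a t = (\<Sum>n. 4 * sin (circ_freq n * a) / (circ_freq n ^ (2 * i + 1) * (t\<^sup>2 + (circ_freq n)\<^sup>2)))"

lemma summable_sine_series:
  "summable (\<lambda>n. 4 * sin (circ_freq n * a) / (circ_freq n ^ (2 * i + 1) * (t\<^sup>2 + (circ_freq n)\<^sup>2)))"
  by (rule summable_over_Suc_squares[OF circ_freq_coeff_bound]) auto

text \<open>One step of long division of 1 / (t^2 + y^2) in powers of t^2.\<close>

lemma divide_square_plus_step:
  fixes y S P t :: real
  assumes "y \<noteq> 0"
  shows "S / (P * y\<^sup>2) - t\<^sup>2 * (S / (P * y\<^sup>2 * (t\<^sup>2 + y\<^sup>2))) = S / (P * (t\<^sup>2 + y\<^sup>2))"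
proof (cases "P = 0")
  case False
  moreover have "t\<^sup>2 + y\<^sup>2 \<noteq> 0" using assms by (simp add: add_nonneg_eq_0_iff)
  ultimately show ?thesis using assms by (simp add: divide_simps) algebra
qed auto

text \<open>
  As functions of \<open>a\<close>, both sides solve \<open>u'' = t\<^sup>2 u\<close> with \<open>u(0) = 1\<close> and \<open>u(1) = -1\<close>.
\<close>

lemma hurwitz_kernel_diff_eq_sine_series_0:
  assumes t: "t > 0" and a: "0 \<le> a" "a \<le> 1"
  shows "hurwitz_kernel a t - hurwitz_kernel (1 - a) t = 1 - 2 * a - t\<^sup>2 * sine_series 0 a t"
proof -
  \<comment> \<open>Differentiating \<open>W\<close> twice term by term would leave a series that
    need not converge absolutely. Instead \<open>W'\<close> is split into the Bernoulli polynomial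
    and \<open>- t^2 * Q\<close>, and \<open>Q\<close> has derivative \<open>- W\<close>.\<close>
  define Q where "Q a = (\<Sum>n. 4 * cos (circ_freq n * a) / (circ_freq n ^ 2 * (t\<^sup>2 + (circ_freq n)\<^sup>2)))" for a
  define W where "W a = sine_series 0 a t" for a
  have nz: "t\<^sup>2 + (circ_freq n)\<^sup>2 \<noteq> 0" "circ_freq n \<noteq> 0" for n
    using circ_freq_ge(3)[of n] t by (auto simp: add_nonneg_eq_0_iff)
  have Qsum: "summable (\<lambda>n. 4 * cos (circ_freq n * a) / (circ_freq n ^ 2 * (t\<^sup>2 + (circ_freq n)\<^sup>2)))" for a
    by (rule summable_over_Suc_squares[OF circ_freq_coeff_bound]) auto
  have Q: "(Q has_field_derivative - W x) (at x)" for x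
  proof -
    have "(Q has_field_derivative (\<Sum>n. - (4 * sin (circ_freq n * x) / (circ_freq n ^ 1 * (t\<^sup>2 + (circ_freq n)\<^sup>2))))) (at x)"
      unfolding Q_def[abs_def]
    proof (rule has_field_derivative_suminf[where ?x0.0 = 0, OF _ _ summable_mult[OF summable_inverse_Suc_squares, of 4] Qsum])
      show "((\<lambda>x. 4 * cos (circ_freq n * x) / (circ_freq n ^ 2 * (t\<^sup>2 + (circ_freq n)\<^sup>2))) has_field_derivative
           - (4 * sin (circ_freq n * x) / (circ_freq n ^ 1 * (t\<^sup>2 + (circ_freq n)\<^sup>2)))) (at x)" for n x
        using nz[of n] by (auto intro!: derivative_eq_intros simp: power2_eq_square)
      show "\<bar>- (4 * sin (circ_freq n * x) / (circ_freq n ^ 1 * (t\<^sup>2 + (circ_freq n)\<^sup>2)))\<bar> \<le> 4 * (1 / (real n + 1)\<^sup>2)" for n x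
        using circ_freq_coeff_bound[of "sin (circ_freq n * x)" n 1 t] by simp
    qed
    thus ?thesis using summable_sine_series[of x 0 t]
      by (simp add: W_def sine_series_def suminf_minus)
  qed
  have W: "(W has_field_derivative (1 / 6 - x + x\<^sup>2) - t\<^sup>2 * Q x) (at x)" if x: "0 \<le> x" "x \<le> 1" for x
  proof -
    have "(W has_field_derivative (\<Sum>n. 4 * cos (circ_freq n * x) / (circ_freq n ^ 0 * (t\<^sup>2 + (circ_freq n)\<^sup>2)))) (at x)"
      unfolding W_def[abs_def] sine_series_def
    proof (rule has_field_derivative_suminf[where ?x0.0 = 0, OF _ _ summable_mult[OF summable_inverse_Suc_squares, of 4] summable_sine_series])
      show "((\<lambda>x. 4 * sin (circ_freq n * x) / (circ_freq n ^ (2 * 0 + 1) * (t\<^sup>2 + (circ_freq n)\<^sup>2))) has_field_derivative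
           4 * cos (circ_freq n * x) / (circ_freq n ^ 0 * (t\<^sup>2 + (circ_freq n)\<^sup>2))) (at x)" for n x
        using nz[of n] by (auto intro!: derivative_eq_intros simp: power2_eq_square)
      show "\<bar>4 * cos (circ_freq n * x) / (circ_freq n ^ 0 * (t\<^sup>2 + (circ_freq n)\<^sup>2))\<bar> \<le> 4 * (1 / (real n + 1)\<^sup>2)" for n x
        using circ_freq_coeff_bound[of "cos (circ_freq n * x)" n 0 t] by simp
    qed
    also have "(\<lambda>n. 4 * cos (circ_freq n * x) / (circ_freq n ^ 0 * (t\<^sup>2 + (circ_freq n)\<^sup>2))) =
       (\<lambda>n. 4 * cos (circ_freq n * x) / (circ_freq n)\<^sup>2 -
            t\<^sup>2 * (4 * cos (circ_freq n * x) / (circ_freq n ^ 2 * (t\<^sup>2 + (circ_freq n)\<^sup>2))))"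
      using divide_square_plus_step[OF nz(2), where P = 1] by (intro ext) simp
    also have "suminf \<dots> = (1 / 6 - x + x\<^sup>2) - t\<^sup>2 * Q x"
      using sums_diff[OF sums_cos_over_circ_freq_square[OF x] sums_mult[OF summable_sums[OF Qsum[of x]], of "t\<^sup>2"]]
      by (simp add: sums_iff Q_def)
    finally show ?thesis .
  qed
  define u where "u x = 1 - 2 * x - t\<^sup>2 * W x" for x
  define p where "p x = - 2 - t\<^sup>2 * (1 / 6 - x + x\<^sup>2) + t ^ 4 * Q x" for x
  have du: "(u has_field_derivative p x) (at x)" if "0 \<le> x" "x \<le> 1" for x
    unfolding u_def[abs_def] p_def by (rule derivative_eq_intros W that refl)+ (simp add: algebra_simps power_numeral_reduce)
  have dp: "(p has_field_derivative t\<^sup>2 * u x) (at x)" for x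
    unfolding p_def[abs_def] u_def by (rule derivative_eq_intros Q refl)+ (simp add: algebra_simps power_numeral_reduce)
  \<comment> \<open>First integrals of u'' = t^2 u, for c = t and c = -t; they take the place of a
    uniqueness theorem.\<close>
  have const: "\<exists>\<alpha>. \<forall>x\<in>{0..1}. (p x + c * u x) * exp (- (c * x)) = \<alpha>" if c: "c\<^sup>2 = t\<^sup>2" for c
  proof (rule has_field_derivative_zero_constant)
    fix x :: real assume x: "x \<in> {0..1}"
    have "((\<lambda>x. (p x + c * u x) * exp (- (c * x))) has_field_derivative
            (t\<^sup>2 * u x + c * p x) * exp (- (c * x)) + (p x + c * u x) * (exp (- (c * x)) * (- c))) (at x)"
      using x by (auto intro!: derivative_eq_intros du dp)
    also have "(t\<^sup>2 * u x + c * p x) * exp (- (c * x)) + (p x + c * u x) * (exp (- (c * x)) * (- c)) = 0"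
      unfolding c[symmetric] by (simp add: algebra_simps power2_eq_square)
    finally show "((\<lambda>x. (p x + c * u x) * exp (- (c * x))) has_field_derivative 0) (at x within {0..1})"
      by (rule has_field_derivative_at_within)
  qed auto
  obtain \<alpha> where \<alpha>: "\<And>x. x \<in> {0..1} \<Longrightarrow> (p x + t * u x) * exp (- (t * x)) = \<alpha>" using const[of t] by auto
  obtain \<beta> where \<beta>: "\<And>x. x \<in> {0..1} \<Longrightarrow> (p x - t * u x) * exp (t * x) = \<beta>" using const[of "-t"] by auto
  have W0: "W 0 = 0" by (simp add: W_def sine_series_def)
  have "sin (circ_freq n) = 0" for n
    using sin_npi2[of "2 * (n + 1)"] by (simp add: circ_freq_def algebra_simps)
  hence W1: "W 1 = 0" by (simp add: W_def sine_series_def)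
  define E where "E = exp t"
  define X where "X = exp (t * a)"
  have E: "E > 1" "E > 0" using t by (auto simp: E_def)
  have X: "X > 0" by (simp add: X_def)
  have p0: "p 0 + t = \<alpha>" "p 0 - t = \<beta>" using \<alpha>[of 0] \<beta>[of 0] by (simp_all add: u_def W0)
  have p1: "p 1 - t = \<alpha> * E" "(p 1 + t) * E = \<beta>"
    using \<alpha>[of 1] \<beta>[of 1] E by (simp_all add: u_def W1 E_def exp_minus field_simps)
  have pa: "p a + t * u a = \<alpha> * X" "(p a - t * u a) * X = \<beta>"
    using \<alpha>[of a] \<beta>[of a] a X by (simp_all add: X_def exp_minus field_simps)
  \<comment> \<open>The values of \<open>u\<close> at 0 and 1 determine both constants; what remains
    is elimination among polynomials in \<open>E\<close> and \<open>X\<close>.\<close>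
  have b: "\<beta> = \<alpha> - 2 * t" using p0 by simp
  have p1': "p 1 + t = \<alpha> * E + 2 * t" using p1 by simp
  have "(\<alpha> * E + 2 * t) * E = \<alpha> - 2 * t" using p1(2) unfolding p1' b .
  hence "(E + 1) * (\<alpha> * (E - 1) + 2 * t) = 0" by algebra
  hence al: "\<alpha> * (E - 1) = - 2 * t" using E by simp
  have "2 * t * u a * X = \<alpha> * X * X - \<beta>" using pa by algebra
  hence "2 * t * u a * X * (E - 1) = 2 * t * (E - X * X)" using al b by algebra
  hence "2 * t * (u a * X * (E - 1)) = 2 * t * (E - X * X)" by (simp add: mult_ac)
  hence ua: "u a * X * (E - 1) = E - X * X" using t by simp
  have "hurwitz_kernel a t - hurwitz_kernel (1 - a) t = (1 / X - X / E) / (1 - 1 / E)"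
    by (simp add: hurwitz_kernel_def X_def E_def exp_minus exp_diff algebra_simps diff_divide_distrib[symmetric] divide_inverse)
  also have "1 / X - X / E = u a * (1 - 1 / E)"
  proof -
    have "1 / X - X / E = (E - X * X) / (X * E)" using E X by (simp add: field_simps)
    also have "\<dots> = u a * (1 - 1 / E)" unfolding ua[symmetric] using E X by (simp add: field_simps)
    finally show ?thesis .
  qed
  also have "u a * (1 - 1 / E) / (1 - 1 / E) = u a" using E by simp
  finally show ?thesis by (simp add: u_def W_def)
qed

text \<open>The Taylor coefficients of the kernel difference in t^2. The case \<open>j = 0\<close>
  is given in closed form because its sine series would converge only conditionally.\<close>

definition sine_coeff :: "real \<Rightarrow> nat \<Rightarrow> real" where
  "sine_coeff a j = (if j = 0 then 1 - 2 * a
     else (- 1) ^ j * (\<Sum>n. 4 * sin (circ_freq n * a) / circ_freq n ^ (2 * j + 1)))"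

lemma sine_series_Suc:
  "sine_series i a t = (\<Sum>n. 4 * sin (circ_freq n * a) / circ_freq n ^ (2 * Suc i + 1)) - t\<^sup>2 * sine_series (Suc i) a t"
proof -
  have nz: "circ_freq n \<noteq> 0" for n
    using circ_freq_ge(3)[of n] by simp
  have "summable (\<lambda>n. 4 * sin (circ_freq n * a) / circ_freq n ^ (2 * Suc i + 1))"
    by (rule summable_over_Suc_squares[OF circ_freq_coeff_bound']) auto
  hence "(\<lambda>n. 4 * sin (circ_freq n * a) / circ_freq n ^ (2 * Suc i + 1) -
          t\<^sup>2 * (4 * sin (circ_freq n * a) / (circ_freq n ^ (2 * Suc i + 1) * (t\<^sup>2 + (circ_freq n)\<^sup>2))))
     sums ((\<Sum>n. 4 * sin (circ_freq n * a) / circ_freq n ^ (2 * Suc i + 1)) - t\<^sup>2 * sine_series (Suc i) a t)"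
    unfolding sine_series_def by (intro sums_diff sums_mult summable_sums summable_sine_series)
  also have "(\<lambda>n. 4 * sin (circ_freq n * a) / circ_freq n ^ (2 * Suc i + 1) -
          t\<^sup>2 * (4 * sin (circ_freq n * a) / (circ_freq n ^ (2 * Suc i + 1) * (t\<^sup>2 + (circ_freq n)\<^sup>2)))) =
       (\<lambda>n. 4 * sin (circ_freq n * a) / (circ_freq n ^ (2 * i + 1) * (t\<^sup>2 + (circ_freq n)\<^sup>2)))"
  proof
    fix n
    have *: "circ_freq n ^ (2 * Suc i + 1) = circ_freq n ^ (2 * i + 1) * (circ_freq n)\<^sup>2"
      by (simp flip: power_add)
    show "4 * sin (circ_freq n * a) / circ_freq n ^ (2 * Suc i + 1) -
          t\<^sup>2 * (4 * sin (circ_freq n * a) / (circ_freq n ^ (2 * Suc i + 1) * (t\<^sup>2 + (circ_freq n)\<^sup>2))) =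
        4 * sin (circ_freq n * a) / (circ_freq n ^ (2 * i + 1) * (t\<^sup>2 + (circ_freq n)\<^sup>2))"
      unfolding * by (rule divide_square_plus_step[OF nz])
  qed
  finally show ?thesis by (simp add: sine_series_def sums_iff)
qed

text \<open>The exact remainder serves twice: it bounds the difference near 0, and divided by its
  power of \<open>t\<close> it is the integrand at the negative odd point.\<close>

lemma hurwitz_kernel_diff_eq_sine_series:
  assumes t: "t > 0" and a: "0 \<le> a" "a \<le> 1"
  shows "hurwitz_kernel a t - hurwitz_kernel (1 - a) t =
    (\<Sum>j\<le>i. sine_coeff a j * t ^ (2 * j)) + (- 1) ^ Suc i * t ^ (2 * Suc i) * sine_series i a t"
proof (induction i)
  case 0
  show ?case
    using hurwitz_kernel_diff_eq_sine_series_0[OF assms] by (simp add: sine_coeff_def)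
next
  case (Suc i)
  show ?case unfolding Suc.IH sine_series_Suc[of i]
    by (simp add: sine_coeff_def algebra_simps power2_eq_square)
qed

section \<open>Integrating the partial fractions over the half line\<close>

lemma set_integral_inverse_square_plus:
  assumes "c > 0"
  shows "set_integrable lborel {0<..} (\<lambda>t::real. 1 / (t\<^sup>2 + c\<^sup>2))"
    and "(LINT t:{0<..}|lborel. 1 / (t\<^sup>2 + c\<^sup>2)) = pi / (2 * c)"
proof -
  have nz: "t\<^sup>2 + c\<^sup>2 \<noteq> 0" for t using assms by (auto simp: add_nonneg_eq_0_iff)
  have "((\<lambda>t. 1 / (t\<^sup>2 + c\<^sup>2)) has_integral pi / (2 * c)) {0..}"
  proof (rule has_integral_to_inf)
    have int: "((\<lambda>t. 1 / (t\<^sup>2 + c\<^sup>2)) has_integral (arctan (y / c) / c - arctan (0 / c) / c)) {0..y}" if "y \<ge> 0" for y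
    proof (rule fundamental_theorem_of_calculus)
      fix x :: real
      have "((\<lambda>y. arctan (y / c) / c) has_field_derivative 1 / (x\<^sup>2 + c\<^sup>2)) (at x within {0..y})"
        using assms nz[of x] by (auto intro!: derivative_eq_intros simp: divide_simps power2_eq_square)
      thus "((\<lambda>y. arctan (y / c) / c) has_vector_derivative 1 / (x\<^sup>2 + c\<^sup>2)) (at x within {0..y})"
        by (simp add: has_real_derivative_iff_has_vector_derivative)
    qed (use that in auto)
    show "(\<lambda>t. 1 / (t\<^sup>2 + c\<^sup>2)) integrable_on {0..y}" for y
      using int[of y] by (cases "y \<ge> 0") auto
    have "((\<lambda>y. arctan (y / c) / c) \<longlongrightarrow> (pi / 2) / c) at_top"
    proof (intro tendsto_divide tendsto_const filterlim_compose[OF tendsto_arctan_at_top])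
      show "filterlim (\<lambda>y. y / c) at_top at_top" using assms by real_asymp
    qed (use assms in auto)
    moreover have "eventually (\<lambda>y. arctan (y / c) / c = integral {0..y} (\<lambda>t. 1 / (t\<^sup>2 + c\<^sup>2))) at_top"
      using eventually_ge_at_top[of 0] by eventually_elim (use integral_unique[OF int] in simp)
    ultimately show "((\<lambda>y. integral {0..y} (\<lambda>t. 1 / (t\<^sup>2 + c\<^sup>2))) \<longlongrightarrow> pi / (2 * c)) at_top"
      by (auto simp: mult.commute intro: Lim_transform_eventually)
  qed auto
  hence "((\<lambda>t. 1 / (t\<^sup>2 + c\<^sup>2)) has_integral pi / (2 * c)) {0<..}"
    by (subst has_integral_spike_set_eq[of _ "{0..}"]) (auto intro: negligible_subset[of "{0}"])
  thus "set_integrable lborel {0<..} (\<lambda>t::real. 1 / (t\<^sup>2 + c\<^sup>2))"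
    and "(LINT t:{0<..}|lborel. 1 / (t\<^sup>2 + c\<^sup>2)) = pi / (2 * c)"
    by (auto intro!: set_integrable_lborel_has_integral)
qed

text \<open>Each term integrates by the arctangent to pi / (2 y), y being its frequency. This adds
  one power of the frequency to the denominator and makes the L1 norms summable.\<close>

lemma integral_sine_series:
  shows "set_integrable lborel {0<..} (sine_series i a)"
    and "(\<lambda>n. 2 * pi * sin (circ_freq n * a) / circ_freq n ^ (2 * Suc i)) sums
           (LINT t:{0<..}|lborel. sine_series i a t)"
proof -
  define f where "f n t = indicator {0<..} t *\<^sub>R (4 * sin (circ_freq n * a) / circ_freq n ^ (2 * i + 1) * (1 / (t\<^sup>2 + (circ_freq n)\<^sup>2)))" for n and t :: real
  have f_eq: "f n t = indicator {0<..} t *\<^sub>R (4 * sin (circ_freq n * a) / (circ_freq n ^ (2 * i + 1) * (t\<^sup>2 + (circ_freq n)\<^sup>2)))" for n t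
    by (simp add: f_def)
  have int: "integrable lborel (f n)" for n
    unfolding f_def set_integrable_def[symmetric]
    by (intro set_integrable_mult_right set_integral_inverse_square_plus circ_freq_ge)
  have sm: "summable (\<lambda>n. norm (f n t))" for t
    unfolding f_eq
    by (rule summable_over_Suc_squares[where C = 4], cases "t > 0")
       (use circ_freq_coeff_bound[of "sin (circ_freq n * a)" n "2 * i + 1" t for n] in auto)
  have ni: "(LINT t|lborel. norm (f n t)) = 2 * pi * \<bar>sin (circ_freq n * a)\<bar> / circ_freq n ^ (2 * Suc i)" for n
  proof -
    have "(LINT t|lborel. norm (f n t)) =
      (LINT t:{0<..}|lborel. 4 * \<bar>sin (circ_freq n * a)\<bar> / circ_freq n ^ (2 * i + 1) * (1 / (t\<^sup>2 + (circ_freq n)\<^sup>2)))"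
      unfolding set_lebesgue_integral_def f_def using circ_freq_ge(3)[of n]
      by (intro Bochner_Integration.integral_cong refl) (simp add: abs_mult indicator_def add_nonneg_pos)
    also have "\<dots> = 4 * \<bar>sin (circ_freq n * a)\<bar> / circ_freq n ^ (2 * i + 1) * (pi / (2 * circ_freq n))"
      by (simp only: set_integral_mult_right set_integral_inverse_square_plus(2)[OF circ_freq_ge(3)])
    finally show ?thesis by (simp add: mult_ac)
  qed
  have sn: "summable (\<lambda>n. LINT t|lborel. norm (f n t))"
  proof (rule summable_over_Suc_squares[where C = "4 * (2 * pi)"])
    fix n
    have "\<bar>4 * \<bar>sin (circ_freq n * a)\<bar> / circ_freq n ^ (2 * Suc i)\<bar> \<le> 4 / (real n + 1)\<^sup>2"
      by (rule circ_freq_coeff_bound') auto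
    hence "2 * pi * \<bar>4 * \<bar>sin (circ_freq n * a)\<bar> / circ_freq n ^ (2 * Suc i)\<bar> \<le> 2 * pi * (4 / (real n + 1)\<^sup>2)"
      by (intro mult_left_mono) auto
    moreover have "\<bar>LINT t|lborel. norm (f n t)\<bar> \<le> 2 * pi * \<bar>4 * \<bar>sin (circ_freq n * a)\<bar> / circ_freq n ^ (2 * Suc i)\<bar>"
      unfolding ni using circ_freq_ge(3)[of n] by (auto simp: abs_mult intro!: divide_right_mono)
    ultimately show "\<bar>LINT t|lborel. norm (f n t)\<bar> \<le> 4 * (2 * pi) / (real n + 1)\<^sup>2" by simp
  qed
  have val: "(LINT t|lborel. f n t) = 2 * pi * sin (circ_freq n * a) / circ_freq n ^ (2 * Suc i)" for n
  proof -
    have "(LINT t|lborel. f n t) = 4 * sin (circ_freq n * a) / circ_freq n ^ (2 * i + 1) * (pi / (2 * circ_freq n))"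
      unfolding f_def set_lebesgue_integral_def[symmetric]
      by (simp only: set_integral_mult_right set_integral_inverse_square_plus(2)[OF circ_freq_ge(3)])
    thus ?thesis by (simp add: mult_ac)
  qed
  have sum_eq: "(\<Sum>n. f n t) = indicator {0<..} t *\<^sub>R sine_series i a t" for t
    by (cases "t > 0") (simp_all add: f_eq sine_series_def)
  show "set_integrable lborel {0<..} (sine_series i a)"
    using integrable_suminf[OF int _ sn] sm unfolding sum_eq set_integrable_def by simp
  show "(\<lambda>n. 2 * pi * sin (circ_freq n * a) / circ_freq n ^ (2 * Suc i)) sums
           (LINT t:{0<..}|lborel. sine_series i a t)"
    using sums_integral[OF int _ sn] sm unfolding sum_eq val set_lebesgue_integral_def by simp
qed

section \<open>The derivative at the negative odd integers\<close>

lemma abs_sine_series_le: "\<bar>sine_series i a t\<bar> \<le> (\<Sum>n. 4 * (1 / (real n + 1)\<^sup>2))"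
  unfolding sine_series_def real_norm_def[symmetric]
proof (rule norm_suminf_le)
  show "norm (4 * sin (circ_freq n * a) / (circ_freq n ^ (2 * i + 1) * (t\<^sup>2 + (circ_freq n)\<^sup>2))) \<le> 4 * (1 / (real n + 1)\<^sup>2)" for n
    using circ_freq_coeff_bound[of "sin (circ_freq n * a)" n "2 * i + 1" t] by simp
qed (intro summable_mult summable_inverse_Suc_squares)

lemma set_integrable_powr_ray:
  assumes "e < -1"
  shows "set_integrable lborel {1<..} (\<lambda>t::real. t powr e)"
    "(LINT t:{1<..}|lborel. t powr e) = - 1 / (e + 1)"
proof -
  have "((\<lambda>t::real. t powr e) has_integral - 1 / (e + 1)) {1<..}"
    using has_integral_powr_to_inf[OF assms, of 1]
    by (subst has_integral_spike_set_eq[of _ "{1..}"]) (auto intro: negligible_subset[of "{1}"])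
  thus "set_integrable lborel {1<..} (\<lambda>t::real. t powr e)"
    "(LINT t:{1<..}|lborel. t powr e) = - 1 / (e + 1)"
    by (auto intro!: set_integrable_lborel_has_integral)
qed

text \<open>Near the point the difference equals \<open>rGamma s * F s\<close> with \<open>F\<close>
  holomorphic and \<open>rGamma\<close> vanishing at the point, so only the derivative of
  \<open>rGamma\<close> times the value of \<open>F\<close> survives.\<close>

lemma hurwitz_zeta_deriv_diff:
  assumes a: "0 < a" "a < 1"
  shows "hurwitz_zeta_deriv a (- of_nat (2 * i + 1)) - hurwitz_zeta_deriv (1 - a) (- of_nat (2 * i + 1)) =
    of_real ((- 1) ^ i * fact (2 * i + 1) * (LINT t:{0<..}|lborel. sine_series i a t))"
proof -
  define s0 :: complex where "s0 = - of_nat (2 * i + 1)"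
  define h where "h t = hurwitz_kernel a t - hurwitz_kernel (1 - a) t" for t
  \<comment> \<open>A decay rate common to both kernels.\<close>
  define c where "c = min a (1 - a)"
  define r where "r t = h t - (\<Sum>j\<le>i. sine_coeff a j * t powr real (2 * j))" for t
  define A where "A s = (LINT t:{0<..1}|lborel. mellin_kernel r s t)" for s
  define B where "B s = (LINT t:{1<..}|lborel. mellin_kernel h s t)" for s
  define F where "F s = A s + (\<Sum>j\<le>i. of_real (sine_coeff a j) / (s + of_real (real (2 * j)))) + B s" for s
  \<comment> \<open>The pole of zeta at 1 and the poles of \<open>F\<close> at even nonpositive
    integers; \<open>s0\<close> is odd and avoids them.\<close>
  define Z :: "complex set" where "Z = insert 1 ((\<lambda>j. - of_nat (2 * j)) ` {..i})"
  define S where "S = {s. Re s > - real (2 * Suc i)} - Z"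
  have c: "c > 0" using a by (simp add: c_def)
  have h: "h \<in> borel_measurable borel" unfolding h_def[abs_def] by measurable
  hence r: "r \<in> borel_measurable borel" unfolding r_def[abs_def] by measurable
  have r_eq: "r t = (- 1) ^ Suc i * t ^ (2 * Suc i) * sine_series i a t" if t: "t > 0" for t
    using hurwitz_kernel_diff_eq_sine_series[OF t, of a i] a
    by (simp only: r_def h_def powr_realpow[OF t])
  have unit: "\<bar>r t\<bar> \<le> (\<Sum>n. 4 * (1 / (real n + 1)\<^sup>2)) * t powr real (2 * Suc i)" if t: "0 < t" "t \<le> 1" for t
    using abs_sine_series_le[of i a t] t
    by (simp add: r_eq powr_realpow abs_mult mult.commute mult_left_mono del: power_Suc mult_Suc_right of_nat_Suc of_nat_mult)
  have ray: "\<bar>h t\<bar> \<le> 2 / (1 - exp (- 1)) * exp (- (c * t))" if t: "1 < t" for t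
  proof -
    have "\<bar>hurwitz_kernel b t\<bar> \<le> 1 / (1 - exp (- 1)) * exp (- (c * t))" if b: "c \<le> b" for b
    proof -
      have "c * t \<le> b * t" using t b by (intro mult_right_mono) auto
      hence "1 / (1 - exp (- 1)) * exp (- (b * t)) \<le> 1 / (1 - exp (- 1)) * exp (- (c * t))"
        by (intro mult_left_mono) auto
      thus ?thesis using hurwitz_kernel_bound[of t b] t by linarith
    qed
    from this[of a] this[of "1 - a"] show ?thesis by (simp add: h_def c_def)
  qed
  have Sop: "open S"
    unfolding S_def Z_def by (intro open_Diff open_halfspace_Re_gt finite_imp_closed) auto
  have "A holomorphic_on {s. Re s > - real (2 * Suc i)}"
    unfolding A_def by (rule mellin_unit_interval(2)[OF r unit])
  hence A: "A holomorphic_on S" by (rule holomorphic_on_subset) (auto simp: S_def)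
  have "B holomorphic_on UNIV" unfolding B_def by (rule mellin_ray(2)[OF h c ray])
  hence B: "B holomorphic_on S" by (rule holomorphic_on_subset) auto
  have nz: "s + of_real (real (2 * j)) \<noteq> 0" if "s \<in> S" "j \<le> i" for s j
    using that by (auto simp: S_def Z_def eq_neg_iff_add_eq_0)
  have F: "F holomorphic_on S"
    unfolding F_def[abs_def] by (intro holomorphic_intros A B nz) auto
  have G: "hurwitz_zeta b holomorphic_on S" if "b > 0" for b
    by (rule holomorphic_on_subset[OF holomorphic_hurwitz_zeta[OF that]]) (auto simp: S_def Z_def)
  have eq: "hurwitz_zeta a s - hurwitz_zeta (1 - a) s = rGamma s * F s" if s: "s \<in> S" for s
  proof (rule analytic_continuation_open[of "{s. Re s > 1}" S
        "\<lambda>s. hurwitz_zeta a s - hurwitz_zeta (1 - a) s" "\<lambda>s. rGamma s * F s"])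
    show "connected S" unfolding S_def Z_def
      by (intro connected_open_delete_finite open_halfspace_Re_gt convex_connected convex_halfspace_Re_gt) auto
    show "{s. Re s > 1} \<noteq> {}" by (auto intro: exI[of _ 2])
    show "{s. Re s > 1} \<subseteq> S" by (auto simp: S_def Z_def)
    fix z assume "z \<in> {s. Re s > 1}"
    hence z: "Re z > 1" by simp
    have int: "set_integrable lborel {0<..} (mellin_kernel (hurwitz_kernel b) z)" if b: "b > 0" for b
    proof -
      \<comment> \<open>The expansion of order 0 is merely a bound by a multiple of 1/t, which
        suffices for Re z > 1.\<close>
      obtain q D where "\<And>t. 0 < t \<Longrightarrow> t \<le> 1 \<Longrightarrow>
          \<bar>hurwitz_kernel b t - (\<Sum>j<0. q j * t powr (real j - 1))\<bar> \<le> D * t powr (real 0 - 1)"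
        using hurwitz_kernel_expansion[of b 0] by blast
      thus ?thesis
        using b hurwitz_kernel_bound[of _ b] z
        by (intro mellin_expansion(1)[where J = "{..<0::nat}" and b = q and p = "\<lambda>j. real j - 1"
             and c = b and C = "1 / (1 - exp (- 1))" and q = "real 0 - 1" and D = D]) auto
    qed
    have "hurwitz_zeta a z - hurwitz_zeta (1 - a) z =
       rGamma z * ((LINT t:{0<..}|lborel. mellin_kernel (hurwitz_kernel a) z t) -
                   (LINT t:{0<..}|lborel. mellin_kernel (hurwitz_kernel (1 - a)) z t))"
      using a z by (simp only: hurwitz_zeta_series mellin_hurwitz_kernel diff_gt_0_iff_gt right_diff_distrib)
    also have "(LINT t:{0<..}|lborel. mellin_kernel (hurwitz_kernel a) z t) -
                   (LINT t:{0<..}|lborel. mellin_kernel (hurwitz_kernel (1 - a)) z t) =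
               (LINT t:{0<..}|lborel. mellin_kernel (hurwitz_kernel a) z t - mellin_kernel (hurwitz_kernel (1 - a)) z t)"
      by (rule set_integral_diff(2)[symmetric]) (use int a in auto)
    also have "(\<lambda>t. mellin_kernel (hurwitz_kernel a) z t - mellin_kernel (hurwitz_kernel (1 - a)) z t) = mellin_kernel h z"
      by (auto simp: mellin_kernel_def h_def algebra_simps)
    also have "(LINT t:{0<..}|lborel. mellin_kernel h z t) = F z"
      unfolding F_def A_def B_def r_def
      by (rule mellin_expansion(2)[OF h c _ ray unit[unfolded r_def]]) (use z in auto)
    finally show "hurwitz_zeta a z - hurwitz_zeta (1 - a) z = rGamma z * F z" .
  qed (use s a in \<open>auto intro!: holomorphic_intros G F Sop open_halfspace_Re_gt\<close>)
  have s0: "s0 \<in> S"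
  proof -
    have "s0 \<noteq> - of_nat (2 * j)" for j
    proof
      assume "s0 = - of_nat (2 * j)"
      hence "of_nat (2 * i + 1) = (of_nat (2 * j) :: complex)" unfolding s0_def by (simp only: neg_equal_iff_equal)
      hence "2 * i + 1 = 2 * j" by (simp only: of_nat_eq_iff)
      thus False by presburger
    qed
    moreover have "s0 \<noteq> 1" by (auto simp: s0_def complex_eq_iff)
    moreover have "Re s0 > - real (2 * Suc i)" by (simp add: s0_def)
    ultimately show ?thesis by (auto simp: S_def Z_def simp del: of_nat_mult)
  qed
  have kern: "mellin_kernel f s0 t = of_real (f t / t ^ (2 * Suc i))" if "t > 0" for f t
  proof -
    have "s0 - 1 = of_real (- real (2 * Suc i))" by (simp add: s0_def)
    hence "mellin_kernel f s0 t = of_real (t powr (- real (2 * Suc i)) * f t)"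
      using that powr_of_real[of t "- real (2 * Suc i)"] by (simp only: mellin_kernel_def) simp
    thus ?thesis using that by (simp add: powr_minus powr_realpow divide_inverse mult.commute del: mult_Suc_right of_nat_Suc power_Suc of_nat_mult)
  qed
  have As0: "A s0 = of_real ((- 1) ^ Suc i * (LINT t:{0<..1}|lborel. sine_series i a t))"
  proof -
    have "A s0 = (LINT t:{0<..1}|lborel. complex_of_real ((- 1) ^ Suc i * sine_series i a t))"
      unfolding A_def by (intro set_lebesgue_integral_cong) (auto simp: kern r_eq)
    thus ?thesis by (simp only: set_integral_complex_of_real set_integral_mult_right)
  qed
  have intS: "set_integrable lborel {0<..1} (sine_series i a)" "set_integrable lborel {1<..} (sine_series i a)"
    by (rule set_integrable_subset[OF integral_sine_series(1)]; auto)+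
  \<comment> \<open>The exponent of t^(2j) in the kernel at \<open>s0\<close>. It is at most -2, so
    each power is integrable over (1,\<infinity>).\<close>
  define e where "e j = real (2 * j) - real (2 * Suc i)" for j
  have e: "e j < -1" "e j + 1 = real (2 * j) - real (2 * i + 1)" if "j \<in> {..i}" for j
    using that by (auto simp: e_def)
  have "B s0 = (LINT t:{1<..}|lborel. complex_of_real ((\<Sum>j\<le>i. sine_coeff a j * t powr e j) + (- 1) ^ Suc i * sine_series i a t))"
    unfolding B_def
  proof (intro set_lebesgue_integral_cong allI impI)
    fix t :: real assume "t \<in> {1<..}"
    hence t: "t > 0" by simp
    have "h t = (\<Sum>j\<le>i. sine_coeff a j * t powr real (2 * j)) + r t" by (simp add: r_def)
    hence "h t / t ^ (2 * Suc i) = (\<Sum>j\<le>i. sine_coeff a j * (t powr real (2 * j) / t powr real (2 * Suc i))) + r t / t ^ (2 * Suc i)"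
      using t by (simp add: add_divide_distrib sum_divide_distrib powr_realpow del: mult_Suc_right of_nat_Suc power_Suc of_nat_mult)
    also have "\<dots> = (\<Sum>j\<le>i. sine_coeff a j * t powr e j) + (- 1) ^ Suc i * sine_series i a t"
      using t by (simp only: powr_diff[symmetric] e_def r_eq[OF t]) simp
    finally show "mellin_kernel h s0 t = complex_of_real ((\<Sum>j\<le>i. sine_coeff a j * t powr e j) + (- 1) ^ Suc i * sine_series i a t)"
      using t by (simp only: kern)
  qed auto
  also have "\<dots> = of_real (LINT t:{1<..}|lborel. (\<Sum>j\<le>i. sine_coeff a j * t powr e j) + (- 1) ^ Suc i * sine_series i a t)"
    by (rule set_integral_complex_of_real)
  also have "(LINT t:{1<..}|lborel. (\<Sum>j\<le>i. sine_coeff a j * t powr e j) + (- 1) ^ Suc i * sine_series i a t) =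
     (\<Sum>j\<le>i. sine_coeff a j * (- 1 / (e j + 1))) + (- 1) ^ Suc i * (LINT t:{1<..}|lborel. sine_series i a t)"
  proof -
    have p: "set_integrable lborel {1<..} (\<lambda>t. sine_coeff a j * t powr e j)" if "j \<in> {..i}" for j
      using e(1)[OF that] by (intro set_integrable_mult_right set_integrable_powr_ray)
    have 1: "set_integrable lborel {1<..} (\<lambda>t. \<Sum>j\<le>i. sine_coeff a j * t powr e j)"
      using p unfolding set_integrable_def scaleR_sum_right by (intro Bochner_Integration.integrable_sum)
    have 2: "set_integrable lborel {1<..} (\<lambda>t. (- 1) ^ Suc i * sine_series i a t)"
      by (intro set_integrable_mult_right intS)
    have "(LINT t:{1<..}|lborel. (\<Sum>j\<le>i. sine_coeff a j * t powr e j)) =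
            (\<Sum>j\<le>i. (LINT t:{1<..}|lborel. sine_coeff a j * t powr e j))"
      using p unfolding set_integrable_def set_lebesgue_integral_def scaleR_sum_right
      by (intro Bochner_Integration.integral_sum)
    also have "\<dots> = (\<Sum>j\<le>i. sine_coeff a j * (- 1 / (e j + 1)))"
      by (intro sum.cong refl) (simp only: set_integral_mult_right set_integrable_powr_ray(2)[OF e(1)])
    finally show ?thesis
      using set_integral_add(2)[OF 1 2] by (simp only: set_integral_mult_right)
  qed
  finally have Bs0: "B s0 = of_real ((\<Sum>j\<le>i. sine_coeff a j * (- 1 / (e j + 1))) + (- 1) ^ Suc i * (LINT t:{1<..}|lborel. sine_series i a t))" .
  have Ps0: "(\<Sum>j\<le>i. of_real (sine_coeff a j) / (s0 + of_real (real (2 * j)))) = complex_of_real (\<Sum>j\<le>i. sine_coeff a j * (1 / (e j + 1)))"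
    unfolding of_real_sum
  proof (intro sum.cong refl)
    fix j assume j: "j \<in> {..i}"
    have "s0 + of_real (real (2 * j)) = of_real (e j + 1)"
      unfolding e(2)[OF j] by (simp add: s0_def)
    thus "of_real (sine_coeff a j) / (s0 + of_real (real (2 * j))) = complex_of_real (sine_coeff a j * (1 / (e j + 1)))"
      by (simp only:) simp
  qed
  \<comment> \<open>The integrals of the powers over (1,\<infinity>) are exactly the negatives of
    the pole terms, so only the two parts of the sine series integral remain.\<close>
  have Fs0: "F s0 = of_real ((- 1) ^ Suc i * (LINT t:{0<..}|lborel. sine_series i a t))"
  proof -
    have split: "{0<..} = {0<..1} \<union> {(1::real)<..}" by auto
    have "(LINT t:{0<..}|lborel. sine_series i a t) =
        (LINT t:{0<..1}|lborel. sine_series i a t) + (LINT t:{1<..}|lborel. sine_series i a t)"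
      unfolding split by (rule set_integral_Un[OF _ intS]) auto
    thus ?thesis
      unfolding F_def As0 Bs0 Ps0 by (simp add: algebra_simps sum_negf)
  qed
  have "((\<lambda>s. rGamma s * F s) has_field_derivative
          ((- 1) ^ (2 * i + 1) * fact (2 * i + 1)) * F s0 + deriv F s0 * rGamma s0) (at s0)"
    by (rule DERIV_mult) (use has_field_derivative_rGamma_nonpos_int[of "2 * i + 1"] holomorphic_derivI[OF F Sop s0] in \<open>auto simp: s0_def\<close>)
  moreover have "rGamma s0 = 0" unfolding s0_def by (intro rGamma_nonpos_Int minus_of_nat_in_nonpos_Ints)
  ultimately have d1: "((\<lambda>s. rGamma s * F s) has_field_derivative - fact (2 * i + 1) * F s0) (at s0)"
    by simp
  have "((\<lambda>s. hurwitz_zeta a s - hurwitz_zeta (1 - a) s) has_field_derivative - fact (2 * i + 1) * F s0) (at s0)"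
    by (rule has_field_derivative_transform_within_open[OF d1 Sop s0]) (simp add: eq)
  moreover have "((\<lambda>s. hurwitz_zeta a s - hurwitz_zeta (1 - a) s) has_field_derivative
      hurwitz_zeta_deriv a s0 - hurwitz_zeta_deriv (1 - a) s0) (at s0)"
    unfolding hurwitz_zeta_deriv_def
    by (intro DERIV_diff holomorphic_derivI[OF G Sop s0]) (use a in auto)
  ultimately have "hurwitz_zeta_deriv a s0 - hurwitz_zeta_deriv (1 - a) s0 = - fact (2 * i + 1) * F s0"
    by (rule DERIV_unique[rotated])
  also have "\<dots> = of_real ((- 1) ^ i * fact (2 * i + 1) * (LINT t:{0<..}|lborel. sine_series i a t))"
    unfolding Fs0 by (simp del: fact_Suc)
  finally show ?thesis by (simp only: s0_def)
qed

section \<open>From derivative values to the trigonometric series\<close>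

lemma sums_sin_hurwitz_zeta_deriv:
  assumes a: "0 < a" "a < 1" and m: "m \<ge> 1"
  shows "(\<lambda>n. complex_of_real (sin (2 * pi * (real n + 1) * a) / (real n + 1) ^ (2 * m))) sums
    (of_real ((- 1) ^ (m - 1) * (2 * pi) ^ (2 * m - 1) / fact (2 * m - 1)) *
      (hurwitz_zeta_deriv a (1 - 2 * of_nat m) - hurwitz_zeta_deriv (1 - a) (1 - 2 * of_nat m)))"
proof -
  obtain i where i: "m = Suc i" using m by (cases m) auto
  define I where "I = (LINT t:{0<..}|lborel. sine_series i a t)"
  have "(\<lambda>n. (2 * pi) ^ (2 * i + 1) * (2 * pi * sin (circ_freq n * a) / circ_freq n ^ (2 * Suc i))) sums
     ((2 * pi) ^ (2 * i + 1) * I)"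
    unfolding I_def by (intro sums_mult integral_sine_series)
  also have "(\<lambda>n. (2 * pi) ^ (2 * i + 1) * (2 * pi * sin (circ_freq n * a) / circ_freq n ^ (2 * Suc i))) =
     (\<lambda>n. sin (2 * pi * (real n + 1) * a) / (real n + 1) ^ (2 * m))"
  proof
    fix n
    have "(2 * pi) ^ (2 * i + 1) * (2 * pi * s / (2 * pi * k) ^ (2 * Suc i)) = s / k ^ (2 * Suc i)" for s k :: real
      by (simp add: power_mult_distrib)
    thus "(2 * pi) ^ (2 * i + 1) * (2 * pi * sin (circ_freq n * a) / circ_freq n ^ (2 * Suc i)) =
        sin (2 * pi * (real n + 1) * a) / (real n + 1) ^ (2 * m)"
      by (simp only: circ_freq_def i)
  qed
  finally have sums: "(\<lambda>n. complex_of_real (sin (2 * pi * (real n + 1) * a) / (real n + 1) ^ (2 * m))) sums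
     of_real ((2 * pi) ^ (2 * i + 1) * I)"
    by (rule sums_of_real)
  have s0: "1 - 2 * of_nat m = (- of_nat (2 * i + 1) :: complex)" by (simp add: i)
  have cancel: "e * P / f * (e * f * I) = P * I" if "e * e = 1" "f \<noteq> 0" for e P f :: real
  proof -
    have "e * P / f * (e * f * I) = (e * e) * (P * I)" using that(2) by (simp add: mult_ac)
    thus ?thesis using that(1) by simp
  qed
  \<comment> \<open>The sign and the factorial of the derivative formula cancel against those in the
    prefactor.\<close>
  have "(- 1) ^ i * (- 1) ^ i = (1 :: real)" by (simp flip: power_mult_distrib)
  from cancel[OF this fact_nonzero[of "2 * i + 1"]]
  have "(- 1) ^ (m - 1) * (2 * pi) ^ (2 * m - 1) / fact (2 * m - 1) * ((- 1) ^ i * fact (2 * i + 1) * I) =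
      (2 * pi) ^ (2 * i + 1) * I" by (simp only: i) simp
  thus ?thesis
    using sums unfolding s0 hurwitz_zeta_deriv_diff[OF a] I_def[symmetric] of_real_mult[symmetric] by (simp only:)
qed

theorem mainTheorem8:
  fixes m :: nat and x :: real
  assumes "m \<ge> 1" and "- (pi / 2) < x" and "x < pi / 2"
  shows "(\<lambda>n::nat. complex_of_real
            ((-1) ^ n * cos (real (2 * n + 1) * x) / real (2 * n + 1) ^ (2 * m)))
         sums
         (complex_of_real ((-1) ^ (m - 1) * (2 * pi) ^ (2 * m - 1) / (2 * fact (2 * m - 1))) *
           (hurwitz_zeta_deriv (1/4 - x / (2 * pi)) (1 - 2 * of_nat m)
          - hurwitz_zeta_deriv (3/4 - x / (2 * pi)) (1 - 2 * of_nat m)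
          + hurwitz_zeta_deriv (1/4 + x / (2 * pi)) (1 - 2 * of_nat m)
          - hurwitz_zeta_deriv (3/4 + x / (2 * pi)) (1 - 2 * of_nat m)))"
proof -
  define y where "y = x / (2 * pi)"
  \<comment> \<open>Hence both 1/4 - y and 1/4 + y lie in (0, 1/2), inside the range of the sine
    formula.\<close>
  have y: "- (1 / 4) < y" "y < 1 / 4" using assms(2,3) by (simp_all add: y_def field_simps)
  define f where "f n = complex_of_real (sin (pi / 2 * (real n + 1)) * cos ((real n + 1) * x) / (real n + 1) ^ (2 * m))" for n
  define V where "V = complex_of_real ((-1) ^ (m - 1) * (2 * pi) ^ (2 * m - 1) / (2 * fact (2 * m - 1))) *
           (hurwitz_zeta_deriv (1/4 - y) (1 - 2 * of_nat m)
          - hurwitz_zeta_deriv (3/4 - y) (1 - 2 * of_nat m)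
          + hurwitz_zeta_deriv (1/4 + y) (1 - 2 * of_nat m)
          - hurwitz_zeta_deriv (3/4 + y) (1 - 2 * of_nat m))"
  have eq: "sin (2 * pi * k * (1/4 - y)) + sin (2 * pi * k * (1/4 + y)) = 2 * (sin (pi / 2 * k) * cos (k * x))" for k
  proof -
    have "2 * pi * k * (1/4 - y) = pi / 2 * k - k * x" "2 * pi * k * (1/4 + y) = pi / 2 * k + k * x"
      by (simp_all add: y_def field_simps)
    thus ?thesis by (simp add: sin_add sin_diff)
  qed
  have "f sums (1 / 2 * (of_real ((- 1) ^ (m - 1) * (2 * pi) ^ (2 * m - 1) / fact (2 * m - 1)) *
      (hurwitz_zeta_deriv (1/4 - y) (1 - 2 * of_nat m) - hurwitz_zeta_deriv (1 - (1/4 - y)) (1 - 2 * of_nat m)) +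
      of_real ((- 1) ^ (m - 1) * (2 * pi) ^ (2 * m - 1) / fact (2 * m - 1)) *
      (hurwitz_zeta_deriv (1/4 + y) (1 - 2 * of_nat m) - hurwitz_zeta_deriv (1 - (1/4 + y)) (1 - 2 * of_nat m))))"
    (is "_ sums ?W")
  proof -
    have f_eq: "f = (\<lambda>n. 1 / 2 * (of_real (sin (2 * pi * (real n + 1) * (1/4 - y)) / (real n + 1) ^ (2 * m)) +
            of_real (sin (2 * pi * (real n + 1) * (1/4 + y)) / (real n + 1) ^ (2 * m))))"
      unfolding of_real_add[symmetric] add_divide_distrib[symmetric] eq by (rule ext) (simp add: f_def)
    show ?thesis unfolding f_eq
      by (intro sums_mult sums_add sums_sin_hurwitz_zeta_deriv) (use y assms(1) in auto)
  qed
  \<comment> \<open>Reflection crosses the pairs: 1 - (1/4 - y) is 3/4 + y, and 1 - (1/4 + y) is 3/4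
    - y.\<close>
  also have "?W = V"
    unfolding V_def by (simp add: algebra_simps add_divide_distrib diff_divide_distrib)
  finally have V: "f sums V" .
  \<comment> \<open>Index \<open>n\<close> stands for the frequency n + 1, so odd indices are the
    even frequencies, where the sine factor vanishes.\<close>
  have odd: "f (Suc (2 * n)) = 0" for n
  proof -
    have "pi / 2 * (real (Suc (2 * n)) + 1) = real (Suc n) * pi" by (simp add: field_simps)
    thus ?thesis unfolding f_def by (simp only: sin_npi) simp
  qed
  have ev: "f (2 * n) = of_real ((-1) ^ n * cos (real (2 * n + 1) * x) / real (2 * n + 1) ^ (2 * m))" for n
  proof -
    have "sin (pi / 2 * (real (2 * n) + 1)) = sin (real n * pi + pi / 2)" by (simp add: field_simps)
    also have "\<dots> = (-1) ^ n" by (simp add: sin_add)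
    finally have "sin (pi / 2 * (real (2 * n) + 1)) = (-1) ^ n" .
    thus ?thesis unfolding f_def by (simp only:) (simp add: add_ac)
  qed
  have "f n = 0" if "n \<notin> range (\<lambda>n. 2 * n)" for n
  proof -
    have "odd n" using that by (auto elim!: evenE)
    thus ?thesis using odd by (auto elim!: oddE)
  qed
  hence "(\<lambda>n. f (2 * n)) sums V"
    using V by (subst sums_mono_reindex) (auto simp: strict_mono_def)
  thus ?thesis by (simp only: ev V_def y_def)
qed

end
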